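(* Let $(X,\mu)$ be a non-atomic probability space equipped with a tree $\mathcal{T}$, and let $\mathcal{M}_{\mathcal{T}}$ be the associated dyadic maximal operator. Let $G_1,G_2:[0,+\infty)\to[0,+\infty)$ be increasing functions, let $g:(0,1]\to[0,+\infty)$ be non-increasing and integrable, and let $k\in(0,1]$. Then $$\sup\left\{\int_K G_1(\mathcal{M}_{\mathcal{T}}\phi)\,G_2(\phi)\,d\mu:\ \phi:X\to[0,+\infty)\text{ measurable},\ \phi^*=g,\ K\subseteq X\text{ measurable with }\mu(K)=k\right\}=\int_0^k G_1\left(\frac1t\int_0^t g(u)\,du\right)G_2(g(t))\,dt,$$ where both sides are understood as elements of $[0,+\infty]$.
   Context: Tree: a set $\mathcal{T}$ of measurable subsets of $X$ is called a tree if: (i) $X\in\mathcal{T}$ and $\mu(I)>0$ for every $I\in\mathcal{T}$; (ii) to every $I\in\mathcal{T}$ there corresponds a finite or countable subset $C(I)\subseteq\mathcal{T}$ containing at least two elements such that the elements of $C(I)$ are pairwise disjoint subsets of $I$ and $I=\bigcup C(I)$; (iii) $\mathcal{T}=\bigcup_{m\ge0}\mathcal{T}_{(m)}$, where $\mathcal{T}_{(0)}=\{X\}$ and $\mathcal{T}_{(m+1)}=\bigcup_{I\in\mathcal{T}_{(m)}}C(I)$; (iv) $\lim_{m\to\infty}\sup_{I\in\mathcal{T}_{(m)}}\mu(I)=0$. Dyadic maximal operator: for $\phi\in L^1(X,\mu)$, $\mathcal{M}_{\mathcal{T}}\phi(x)=\sup\left\{\frac{1}{\mu(I)}\int_I|\phi|\,d\mu:\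 x\in I\in\mathcal{T}\right\}$. Decreasing rearrangement: $\phi^*(t)=\sup_{e\subseteq X,\ \mu(e)=t}\left[\inf_{x\in e}|\phi(x)|\right]$ for $t\in(0,1]$. The equality $\phi^*=g$ is understood almost everywhere on $(0,1]$ (i.e. $|\phi|$ and $g$ are equimeasurable). "Increasing" is meant in the weak sense (non-decreasing). *)

theory Defs
  imports "HOL-Probability.Probability"
begin

definition nonatomic :: "'a measure \<Rightarrow> bool" where
  "nonatomic M \<longleftrightarrow>
     (\<forall>A\<in>sets M. emeasure M A > 0 \<longrightarrow>
        (\<exists>B\<in>sets M. B \<subseteq> A \<and> 0 < emeasure M B \<and> emeasure M B < emeasure M A))"

primrec tree_level :: "'a measure \<Rightarrow> ('a set \<Rightarrow> 'a set set) \<Rightarrow> nat \<Rightarrow> 'a set set" where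
  "tree_level M C 0 = {space M}"
| "tree_level M C (Suc m) = (\<Union>I\<in>tree_level M C m. C I)"

definition is_tree :: "'a measure \<Rightarrow> 'a set set \<Rightarrow> bool" where
  "is_tree M T \<longleftrightarrow>
     T \<subseteq> sets M \<and>
     space M \<in> T \<and>
     (\<forall>I\<in>T. emeasure M I > 0) \<and>
     (\<exists>C.
        (\<forall>I\<in>T. C I \<subseteq> T \<and> countable (C I) \<and> (\<exists>A\<in>C I. \<exists>B\<in>C I. A \<noteq> B) \<and>
               disjoint (C I) \<and> I = \<Union>(C I)) \<and>
        T = (\<Union>m. tree_level M C m) \<and>
        (\<lambda>m. SUP I\<in>tree_level M C m. emeasure M I) \<longlonglongrightarrow> 0)"

text \<open>The supremum may be infinite at some points, hence the extended values.\<close>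

definition dyadic_maximal :: "'a measure \<Rightarrow> 'a set set \<Rightarrow> ('a \<Rightarrow> real) \<Rightarrow> 'a \<Rightarrow> ennreal" where
  "dyadic_maximal M T \<phi> x =
     (SUP I\<in>{I\<in>T. x \<in> I}. (\<integral>\<^sup>+y\<in>I. ennreal \<bar>\<phi> y\<bar> \<partial>M) / emeasure M I)"

definition decr_rearrangement :: "'a measure \<Rightarrow> ('a \<Rightarrow> real) \<Rightarrow> real \<Rightarrow> ennreal" where
  "decr_rearrangement M \<phi> t =
     (SUP e\<in>{e\<in>sets M. emeasure M e = ennreal t}. INF x\<in>e. ennreal \<bar>\<phi> x\<bar>)"

end

(* Write A t for the average of g over (0,t].

   Upper bound: stopping the tree at the maximal cells where the average of \<phi> exceeds a gives
   a * mu(E) <= int_E \<phi> <= int_0^mu(E) g for E = {M\<phi> > a}, so the rearrangement of M\<phi> lies below A.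
   Applying increasing functions preserves such a bound, and two layer cake decompositions reduce the
   integral over K to mu(K \<inter> {X1 >= a} \<inter> {X2 >= b}), which is at most the smallest of the three
   measures; the corresponding three subsets of (0,1] all contain the interval from 0 of that length.

   Lower bound: for 0 < q < 1 there are nested unions of tree cells and a function \<tau> on X which on
   every cell of the n-th union is uniformly distributed over (0,q^n]. Then \<phi> = g o \<tau> has
   rearrangement g, and its average over such a cell is A(q^n), so M\<phi> >= A(min 1 (\<tau>/q)). With
   K = {\<tau> <= k}, Fatou's lemma for q -> 1 gives the right-hand side, because the decreasing function
   G1 o A is continuous almost everywhere. *)

theory Submission
  imports Defs
begin

text \<open>The maximal function only sees averages over tree cells. In the lower bound each stratum
  must therefore consist of cells and still occupy exactly the fraction q of every cell of the
  stratum before it. This is achieved with a real coordinate on X, \<open>tag\<close>, whose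
  distribution has no atoms and whose strict sublevel sets are unions of cells. Its normalised
  distribution function inside a cell J, \<open>tag_rank J\<close>, is uniform on [0,1], so the part
  of J with rank below q has the right measure and is a countable union of cells, in each of which
  the construction starts afresh. The same coordinate cuts subsets of exact measure out of a given
  set, which ties \<open>decr_rearrangement\<close> to the distribution function.

  The loss of a factor q comes from using discrete scales: a point whose value lies between q^(n+1)
  and q^n is only known to lie in a cell with average A(q^n).\<close>

section \<open>Countable disjoint unions and ternary expansions\<close>

lemma emeasure_Union_disjoint_mono:
  assumes F: "countable F" "disjoint F" "F \<subseteq> sets M" and N: "sets N = sets M"
    and le: "\<And>J. J \<in> F \<Longrightarrow> c * emeasure M J \<le> emeasure N J"
  shows "c * emeasure M (\<Union>F) \<le> emeasure N (\<Union>F)"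
proof -
  have U: "emeasure L (\<Union>F) = (\<integral>\<^sup>+J. emeasure L J \<partial>count_space F)" if "sets L = sets M" for L
    using emeasure_UN_countable[of F "\<lambda>J. J" L] F that
    by (simp add: disjoint_family_on_def disjoint_def subset_eq)
  show ?thesis
    by (simp add: U N nn_integral_cmult[symmetric] del: nn_integral_cmult) (intro nn_integral_mono, simp add: le)
qed

lemma emeasure_Union_disjoint_scale:
  assumes F: "countable F" "disjoint F" "F \<subseteq> sets M" and A: "\<And>J. J \<in> F \<Longrightarrow> J \<inter> A \<in> sets M"
    and eq: "\<And>J. J \<in> F \<Longrightarrow> emeasure M (J \<inter> A) = c * emeasure M J"
  shows "\<Union>F \<inter> A \<in> sets M" "emeasure M (\<Union>F \<inter> A) = c * emeasure M (\<Union>F)"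
proof -
  have *: "\<Union>F \<inter> A = (\<Union>J\<in>F. J \<inter> A)" by blast
  show "\<Union>F \<inter> A \<in> sets M"
    unfolding * using F A by (intro sets.countable_UN'') auto
  have "emeasure M (\<Union>F \<inter> A) = (\<integral>\<^sup>+J. emeasure M (J \<inter> A) \<partial>count_space F)"
    unfolding * using F A by (intro emeasure_UN_countable) (auto simp: disjoint_family_on_def disjoint_def)
  also have "\<dots> = (\<integral>\<^sup>+J. c * emeasure M J \<partial>count_space F)"
    by (intro nn_integral_cong) (simp add: eq)
  also have "\<dots> = c * (\<integral>\<^sup>+J. emeasure M J \<partial>count_space F)"
    by (intro nn_integral_cmult) simp
  also have "(\<integral>\<^sup>+J. emeasure M J \<partial>count_space F) = emeasure M (\<Union>F)"
    using emeasure_UN_countable[of F "\<lambda>J. J" M] F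
    by (simp add: disjoint_family_on_def disjoint_def subset_eq)
  finally show "emeasure M (\<Union>F \<inter> A) = c * emeasure M (\<Union>F)" .
qed

text \<open>At the first index k where the digits differ, the terms differ by 3^-k, while all later
  terms together contribute at most half of that. Base 2 would not do: there the tail can cancel the
  first difference exactly.\<close>

lemma ternary_series_inj:
  fixes a b :: "nat \<Rightarrow> real"
  assumes a: "\<And>j. a j \<in> {0, 1}" and b: "\<And>j. b j \<in> {0, 1}"
    and eq: "(\<Sum>j. a j * (1/3)^j) = (\<Sum>j. b j * (1/3)^j)"
  shows "a = b"
proof (rule ccontr)
  assume "a \<noteq> b"
  define d where "d j = a j - b j" for j
  have d: "\<bar>d j\<bar> \<le> 1" for j using a[of j] b[of j] by (auto simp: d_def)
  define k where "k = (LEAST j. d j \<noteq> 0)"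
  have "\<exists>j. d j \<noteq> 0" using \<open>a \<noteq> b\<close> by (auto simp: d_def)
  then have k: "d k \<noteq> 0" unfolding k_def by (rule LeastI_ex)
  have k0: "d j = 0" if "j < k" for j using not_less_Least that unfolding k_def by blast
  have k1: "\<bar>d k\<bar> = 1" using k a[of k] b[of k] by (auto simp: d_def)
  have g: "summable (\<lambda>j. (1/3::real)^j)" by (simp add: summable_geometric)
  have s: "summable (\<lambda>j. c j * (1/3)^j)" if "\<And>j. c j \<in> {0, 1}" for c :: "nat \<Rightarrow> real"
  proof (rule summable_comparison_test'[OF g, of 0])
    show "norm (c j * (1/3)^j) \<le> (1/3)^j" for j using that[of j] by auto
  qed
  note sa = s[of a, OF a] and sb = s[of b, OF b]
  have sd: "summable (\<lambda>j. d j * (1/3)^j)"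
    using summable_diff[OF sa sb] by (simp add: d_def algebra_simps)
  have s0: "(\<Sum>j. d j * (1/3)^j) = 0"
    using suminf_diff[OF sa sb] eq by (simp add: d_def algebra_simps)
  have "(\<Sum>j<Suc k. d j * (1/3)^j) = d k * (1/3)^k" using k0 by simp
  then have "0 = (\<Sum>j. d (j + Suc k) * (1/3)^(j + Suc k)) + d k * (1/3)^k"
    using suminf_split_initial_segment[OF sd, of "Suc k"] s0 by simp
  then have "(\<Sum>j. d (j + Suc k) * (1/3)^(j + Suc k)) = - (d k * (1/3)^k)" by linarith
  then have 1: "(1/3)^k = \<bar>\<Sum>j. d (j + Suc k) * (1/3)^(j + Suc k)\<bar>"
    using k1 by (simp only: abs_minus_cancel abs_mult) simp
  have g': "(\<lambda>j. (1/3::real)^(j + Suc k)) sums ((1/3)^k / 2)"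
    using sums_mult[OF geometric_sums[of "1/3::real"], of "(1/3)^Suc k"]
    by (simp add: power_add algebra_simps)
  have "\<bar>\<Sum>j. d (j + Suc k) * (1/3)^(j + Suc k)\<bar> \<le> (\<Sum>j. (1/3::real)^(j + Suc k))"
  proof (subst real_norm_def[symmetric], rule norm_suminf_le)
    show "norm (d (j + Suc k) * (1/3)^(j + Suc k)) \<le> (1/3)^(j + Suc k)" for j
      using mult_right_mono[OF d, of "(1/3)^(j + Suc k)" "j + Suc k"] by (simp add: abs_mult)
  qed (rule sums_summable[OF g'])
  also have "\<dots> = (1/3)^k / 2" using g' by (simp add: sums_iff)
  finally show False using 1 by (simp add: field_simps)
qed

subsection \<open>Trees and stopping families\<close>

locale tree_space = prob_space M for M :: "'a measure" +
  fixes T :: "'a set set" and C :: "'a set \<Rightarrow> 'a set set"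
  assumes T_sets: "T \<subseteq> sets M"
    and T_pos: "I \<in> T \<Longrightarrow> emeasure M I > 0"
    and space_T: "space M \<in> T"
    and C_sub: "I \<in> T \<Longrightarrow> C I \<subseteq> T"
    and C_countable: "I \<in> T \<Longrightarrow> countable (C I)"
    and C_disjoint: "I \<in> T \<Longrightarrow> disjoint (C I)"
    and C_Union: "I \<in> T \<Longrightarrow> \<Union>(C I) = I"
    and T_levels: "T = (\<Union>m. tree_level M C m)"
    and level_lim: "(\<lambda>m. SUP I\<in>tree_level M C m. emeasure M I) \<longlonglongrightarrow> 0"
begin

abbreviation level :: "nat \<Rightarrow> 'a set set" where "level \<equiv> tree_level M C"

lemma level_T: "I \<in> level m \<Longrightarrow> I \<in> T" by (auto simp: T_levels)

lemma countable_level: "countable (level m)"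
  by (induction m) (auto intro: C_countable level_T)

lemma countable_T: "countable T" by (simp add: T_levels countable_level)

lemma T_measurable[measurable]: "I \<in> T \<Longrightarrow> I \<in> sets M" using T_sets by auto

lemma Union_level: "\<Union>(level m) = space M"
proof (induction m)
  case (Suc m)
  have "\<Union>(level (Suc m)) = (\<Union>I\<in>level m. \<Union>(C I))" by auto
  also have "\<dots> = \<Union>(level m)" using level_T C_Union by simp
  finally show ?case using Suc by simp
qed simp

lemma disjoint_level: "disjoint (level m)"
proof (induction m)
  case (Suc m)
  show ?case
  proof (rule disjointI)
    fix A B assume "A \<in> level (Suc m)" "B \<in> level (Suc m)" "A \<noteq> B"
    then obtain I J where IJ: "I \<in> level m" "J \<in> level m" "A \<in> C I" "B \<in> C J" by auto
    then have "A \<subseteq> I" "B \<subseteq> J" using C_Union level_T by blast+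
    show "A \<inter> B = {}"
    proof (cases "I = J")
      case True
      then show ?thesis using C_disjoint[OF level_T[OF IJ(1)]] IJ \<open>A \<noteq> B\<close> by (simp add: disjoint_def)
    next
      case False
      then have "I \<inter> J = {}" using Suc IJ(1,2) by (simp add: disjoint_def)
      then show ?thesis using \<open>A \<subseteq> I\<close> \<open>B \<subseteq> J\<close> by blast
    qed
  qed
qed (simp add: disjoint_def)

definition cell :: "nat \<Rightarrow> 'a \<Rightarrow> 'a set" where
  "cell m x = (THE I. I \<in> level m \<and> x \<in> I)"

lemma cell_eq: "I \<in> level m \<Longrightarrow> x \<in> I \<Longrightarrow> cell m x = I"
  unfolding cell_def using disjoint_level[of m] by (intro the_equality) (auto simp: disjoint_def)

lemma cell: assumes "x \<in> space M" shows cell_level: "cell m x \<in> level m" and mem_cell: "x \<in> cell m x"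
proof -
  obtain I where "I \<in> level m" "x \<in> I" using Union_level[of m] assms by auto
  then show "cell m x \<in> level m" "x \<in> cell m x" using cell_eq by auto
qed

lemma cell_T: "x \<in> space M \<Longrightarrow> cell m x \<in> T" using cell_level level_T by blast

lemma level_space: "I \<in> level m \<Longrightarrow> I \<subseteq> space M" using Union_level by auto

lemma T_space: "I \<in> T \<Longrightarrow> I \<subseteq> space M" using level_space T_levels by auto

lemma T_cell: "I \<in> T \<Longrightarrow> \<exists>m. \<forall>x\<in>I. cell m x = I"
  using cell_eq by (auto simp: T_levels)

lemma cell_Suc: assumes x: "x \<in> space M" shows "cell (Suc m) x \<subseteq> cell m x"
proof -
  obtain J where J: "J \<in> level m" "cell (Suc m) x \<in> C J"
    using cell_level[OF x, of "Suc m"] by auto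
  then have sub: "cell (Suc m) x \<subseteq> J" using C_Union level_T by blast
  then show ?thesis using cell_eq[OF J(1)] mem_cell[OF x] by blast
qed

lemma cell_antimono: "x \<in> space M \<Longrightarrow> i \<le> j \<Longrightarrow> cell j x \<subseteq> cell i x"
  using lift_Suc_antimono_le[of "\<lambda>m. cell m x"] cell_Suc by blast

lemma cell_cong: "x \<in> space M \<Longrightarrow> y \<in> cell j x \<Longrightarrow> i \<le> j \<Longrightarrow> cell i y = cell i x"
  using cell_antimono cell_level cell_eq by blast

text \<open>Calderon-Zygmund selection: along the branch of cells shrinking around a point, the
  first one with property \<open>Q\<close> is kept. Ordering by level makes existence a matter of
  \<open>LEAST\<close>.\<close>

definition stopping :: "('a set \<Rightarrow> bool) \<Rightarrow> 'a set set" where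
  "stopping Q = {cell m x | m x. x \<in> space M \<and> Q (cell m x) \<and> (\<forall>j<m. \<not> Q (cell j x))}"

lemma stopping_T: "stopping Q \<subseteq> T" by (auto simp: stopping_def cell_T)

lemma stopping_Q: "I \<in> stopping Q \<Longrightarrow> Q I" by (auto simp: stopping_def)

lemma countable_stopping: "countable (stopping Q)"
  using stopping_T countable_T by (rule countable_subset)

text \<open>A common point z of two selected cells has the same branch as x down to level m and as y
  down to level n. Both levels are thus the first one at which \<open>Q\<close> holds on the branch
  of z.\<close>

lemma disjoint_stopping: "disjoint (stopping Q)"
proof (rule disjointI, rule ccontr)
  fix I J assume IJ: "I \<in> stopping Q" "J \<in> stopping Q" "I \<noteq> J" "I \<inter> J \<noteq> {}"
  obtain m x where x: "x \<in> space M" "I = cell m x" "Q I" "\<forall>j<m. \<not> Q (cell j x)"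
    using IJ by (auto simp: stopping_def)
  obtain n y where y: "y \<in> space M" "J = cell n y" "Q J" "\<forall>j<n. \<not> Q (cell j y)"
    using IJ by (auto simp: stopping_def)
  obtain z where z: "z \<in> I" "z \<in> J" using IJ by auto
  have "cell j z = cell j x" if "j \<le> m" for j using x z that by (intro cell_cong) auto
  moreover have "cell j z = cell j y" if "j \<le> n" for j using y z that by (intro cell_cong) auto
  ultimately have "m = n" "cell m x = cell n y" using x y
    by (metis linorder_neqE_nat order.refl order.strict_implies_order)+
  then show False using x y IJ by simp
qed

lemma mem_Union_stopping: assumes "I \<in> T" "Q I" "x \<in> I" shows "x \<in> \<Union>(stopping Q)"
proof -
  have x: "x \<in> space M" using assms T_space by blast
  obtain m where "cell m x = I" using T_cell assms by blast
  then have ex: "Q (cell m x)" using assms by simp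
  define n where "n = (LEAST n. Q (cell n x))"
  have "Q (cell n x)" unfolding n_def using ex by (rule LeastI)
  moreover have "\<forall>j<n. \<not> Q (cell j x)" using not_less_Least unfolding n_def by blast
  ultimately have "cell n x \<in> stopping Q" using x unfolding stopping_def by blast
  then show ?thesis using mem_cell[OF x] by blast
qed

lemma Union_stopping: "\<Union>(stopping Q) = \<Union>{I\<in>T. Q I}"
  using mem_Union_stopping stopping_T stopping_Q by blast

text \<open>Points with equal tags lie in the same tree sets, so the tag has no atoms; the minus sign makes
  the sets \<open>{x. tag x < c}\<close> unions of tree sets.\<close>

definition tag :: "'a \<Rightarrow> real" where
  "tag x = - (\<Sum>j. indicator (from_nat_into T j) x * (1/3)^j)"

lemma from_nat_into_T: "from_nat_into T j \<in> T"
  using space_T by (intro from_nat_into) auto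

lemma summable_tag: "summable (\<lambda>j. indicator (A j) x * (1/3::real)^j)"
  by (rule summable_comparison_test'[of "\<lambda>j. (1/3::real)^j" 0])
     (auto simp: summable_geometric indicator_def)

lemma tag_measurable[measurable]: "tag \<in> borel_measurable M"
proof -
  have [measurable]: "from_nat_into T j \<in> sets M" for j using from_nat_into_T by simp
  show ?thesis unfolding tag_def by measurable
qed

text \<open>The series is at most 3/2, so -2 lies strictly below all tags; -2 and 0 later serve as
  end points for the intermediate value theorem.\<close>

lemma tag_bounds: "-2 < tag x" "tag x \<le> 0"
proof -
  have "(\<Sum>j. indicator (from_nat_into T j) x * (1/3::real)^j) \<le> (\<Sum>j. (1/3::real)^j)"
    by (intro suminf_le summable_tag) (auto simp: summable_geometric indicator_def)
  also have "\<dots> = 3/2" by (subst suminf_geometric) auto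
  finally show "-2 < tag x" by (simp add: tag_def)
  show "tag x \<le> 0" unfolding tag_def by (simp add: suminf_nonneg summable_tag)
qed

lemma tag_inj: assumes "tag x = tag y" "I \<in> T" shows "x \<in> I \<longleftrightarrow> y \<in> I"
proof -
  have "(\<lambda>j. indicator (from_nat_into T j) x :: real) = (\<lambda>j. indicator (from_nat_into T j) y)"
    using assms(1) by (intro ternary_series_inj) (auto simp: tag_def indicator_def)
  moreover obtain j where "I = from_nat_into T j"
    using from_nat_into_surj[OF countable_T assms(2)] by metis
  ultimately show ?thesis by (metis indicator_eq_1_iff)
qed

text \<open>By \<open>tag_inj\<close> a fibre of \<open>tag\<close> lies in a single cell of every
  level, and by \<open>level_lim\<close> the measures of these cells tend to 0.\<close>

lemma tag_atomless: "emeasure M {x\<in>space M. tag x = c} = 0"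
proof -
  have "emeasure M {x\<in>space M. tag x = c} \<le> (SUP I\<in>level m. emeasure M I)" for m
  proof (cases "{x\<in>space M. tag x = c} = {}")
    case False
    then obtain x where x: "x \<in> space M" "tag x = c" by auto
    have "{x\<in>space M. tag x = c} \<subseteq> cell m x"
      using x tag_inj[of x _ "cell m x"] cell_T[OF x(1), of m] mem_cell[OF x(1), of m] by auto
    then have "emeasure M {x\<in>space M. tag x = c} \<le> emeasure M (cell m x)"
      using cell_T[OF x(1)] by (intro emeasure_mono) auto
    also have "\<dots> \<le> (SUP I\<in>level m. emeasure M I)" using cell_level[OF x(1)] by (intro SUP_upper)
    finally show ?thesis .
  qed (simp only: emeasure_empty, simp)
  then have "emeasure M {x\<in>space M. tag x = c} \<le> 0"
    by (intro LIMSEQ_le_const[OF level_lim]) auto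
  then show ?thesis by simp
qed

text \<open>Some partial sum of N terms at x already exceeds -c. Close to x no indicator among these
  terms drops from 1 to 0, and the remaining terms are nonnegative.\<close>

lemma tag_open: assumes x: "x \<in> space M" "tag x < c" shows "\<exists>m. \<forall>y\<in>cell m x. tag y < c"
proof -
  let ?s = "\<lambda>x j. indicator (from_nat_into T j) x * (1/3::real)^j"
  have "(\<lambda>N. \<Sum>j<N. ?s x j) \<longlonglongrightarrow> (\<Sum>j. ?s x j)"
    by (intro summable_LIMSEQ summable_tag)
  moreover have "- c < (\<Sum>j. ?s x j)" using x by (simp add: tag_def)
  ultimately have "eventually (\<lambda>N. - c < (\<Sum>j<N. ?s x j)) sequentially" by (rule order_tendstoD)
  then obtain N where N: "- c < (\<Sum>j<N. ?s x j)" by (auto simp: eventually_sequentially)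
  obtain l where l: "\<And>j y. y \<in> from_nat_into T j \<Longrightarrow> cell (l j) y = from_nat_into T j"
    using T_cell[OF from_nat_into_T] by metis
  \<comment> \<open>At this depth the cell of x is contained in each of the first N tree sets that
    contain x; \<open>insert 0\<close> covers N = 0.\<close>
  define m where "m = Max (insert 0 (l ` {..<N}))"
  have lm: "l j \<le> m" if "j < N" for j unfolding m_def using that by (intro Max_ge) auto
  show ?thesis
  proof (intro exI ballI)
    fix y assume y: "y \<in> cell m x"
    have "?s x j \<le> ?s y j" if "j < N" for j
    proof (cases "x \<in> from_nat_into T j")
      case True
      have "y \<in> cell (l j) x" using y cell_antimono[OF x(1) lm[OF that]] by blast
      then show ?thesis using l[OF True] True by simp
    qed simp
    then have "(\<Sum>j<N. ?s x j) \<le> (\<Sum>j<N. ?s y j)" by (intro sum_mono) auto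
    also have "\<dots> \<le> (\<Sum>j. ?s y j)" by (intro sum_le_suminf summable_tag) auto
    finally show "tag y < c" using N by (simp add: tag_def)
  qed
qed

end

section \<open>Ranks of points with respect to the tag\<close>

context tree_space begin

definition tag_cdf :: "'a set \<Rightarrow> real \<Rightarrow> real" where
  "tag_cdf S c = measure M {y\<in>S. tag y \<le> c}"

text \<open>The probability integral transform of \<open>tag\<close> under the normalised
  restriction of M to S.\<close>

definition tag_rank :: "'a set \<Rightarrow> 'a \<Rightarrow> real" where
  "tag_rank S x = tag_cdf S (tag x) / measure M S"

lemma tag_le_sets[measurable]: "S \<in> sets M \<Longrightarrow> {y\<in>S. tag y \<le> c} \<in> sets M"
proof -
  assume S: "S \<in> sets M"
  have "{y\<in>S. tag y \<le> c} = S \<inter> {y\<in>space M. tag y \<le> c}" using sets.sets_into_space[OF S] by auto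
  then show ?thesis using S by simp
qed

lemma tag_cdf_mono: "S \<in> sets M \<Longrightarrow> mono (tag_cdf S)"
  unfolding tag_cdf_def by (intro monoI finite_measure_mono tag_le_sets) auto

lemma tag_cdf_0: "tag_cdf S 0 = measure M S"
  using tag_bounds by (simp add: tag_cdf_def)

lemma tag_cdf_neg: "tag_cdf S (-2) = 0"
  using tag_bounds by (simp add: tag_cdf_def not_le[symmetric])

text \<open>\<open>tag_cdf S\<close> is the distribution function of the image of M restricted to S,
  and that image has no atom at c by \<open>tag_atomless\<close>.\<close>

lemma isCont_tag_cdf: assumes S[measurable]: "S \<in> sets M" shows "isCont (tag_cdf S) c"
proof -
  define N where "N = distr (restrict_space M S) borel tag"
  have t[measurable]: "tag \<in> borel_measurable (restrict_space M S)"
    by (intro measurable_restrict_space1) simp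
  have sp: "space M \<inter> S = S" using sets.sets_into_space[OF S] by auto
  interpret R: finite_measure "restrict_space M S"
    by (rule finite_measureI) (simp add: emeasure_restrict_space sp space_restrict_space)
  interpret N: finite_borel_measure N
    unfolding N_def finite_borel_measure_def finite_borel_measure_axioms_def
    by (simp add: R.finite_measure_distr)
  have m: "measure N B = measure M (tag -` B \<inter> S)" if "B \<in> sets borel" for B
    unfolding N_def using that
    by (subst measure_distr) (auto simp: space_restrict_space sp measure_restrict_space)
  have "measure M (tag -` {c} \<inter> S) \<le> measure M {x\<in>space M. tag x = c}"
    using sets.sets_into_space[OF S] by (intro finite_measure_mono) auto
  also have "\<dots> = 0" using tag_atomless[of c] by (simp add: measure_def)
  finally have "measure N {c} = 0" by (simp add: m measure_nonneg order_antisym)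
  then have "isCont (cdf N) c" by (simp add: N.isCont_cdf)
  also have "cdf N = tag_cdf S"
    by (rule ext) (simp add: cdf_def m tag_cdf_def Int_def vimage_def conj_commute)
  finally show ?thesis .
qed

text \<open>Sierpinski's property of atomless measures, with tag sublevel sets as explicit subsets
  of the prescribed measure.\<close>

lemma tag_cdf_surj:
  assumes "S \<in> sets M" "0 \<le> t" "t \<le> measure M S"
  shows "\<exists>c. tag_cdf S c = t"
  using IVT[of "tag_cdf S" "-2" t 0] assms isCont_tag_cdf by (auto simp: tag_cdf_0 tag_cdf_neg)

lemma rank_measurable[measurable]: "S \<in> sets M \<Longrightarrow> tag_rank S \<in> borel_measurable M"
  unfolding tag_rank_def using borel_measurable_mono[OF tag_cdf_mono] by simp

lemma rank_bounds: assumes "S \<in> sets M" shows "0 \<le> tag_rank S x" "tag_rank S x \<le> 1"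
proof -
  show "0 \<le> tag_rank S x" by (simp add: tag_rank_def tag_cdf_def)
  have "tag_cdf S (tag x) \<le> measure M S"
    unfolding tag_cdf_def using assms by (intro finite_measure_mono) auto
  then show "tag_rank S x \<le> 1" using measure_nonneg[of M S] by (auto simp add: tag_rank_def divide_le_eq_1 less_le)
qed

lemma
  assumes S: "S \<in> sets M"
  shows rank_le_sets[measurable]: "{x\<in>S. tag_rank S x \<le> t} \<in> sets M"
    and rank_less_sets[measurable]: "{x\<in>S. tag_rank S x < t} \<in> sets M"
proof -
  have "{x\<in>S. tag_rank S x \<le> t} = S \<inter> {x\<in>space M. tag_rank S x \<le> t}"
    "{x\<in>S. tag_rank S x < t} = S \<inter> {x\<in>space M. tag_rank S x < t}"
    using sets.sets_into_space[OF S] by auto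
  then show "{x\<in>S. tag_rank S x \<le> t} \<in> sets M" "{x\<in>S. tag_rank S x < t} \<in> sets M"
    using S rank_measurable[OF S] by simp_all
qed

text \<open>\<open>tag_cdf\<close> may be constant on intervals, so rank sublevel sets need not be
  tag sublevel sets. For c with \<open>tag_cdf S c = t * measure M S\<close>, only the inclusions of
  {rank < t} in {tag <= c} and of {tag <= c} in {rank <= t} are available; they give one bound each.
  The opposite bounds follow by comparison with nearby levels w. The extreme levels t = 1 and t = 0,
  which leave no room for w, follow from \<open>rank_bounds\<close>.\<close>

lemma
  assumes S: "S \<in> sets M" and pos: "0 < measure M S" and t: "0 \<le> t" "t \<le> 1"
  shows measure_rank_le: "measure M {x\<in>S. tag_rank S x \<le> t} = t * measure M S" (is ?le)
    and measure_rank_less: "measure M {x\<in>S. tag_rank S x < t} = t * measure M S" (is ?less)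
proof -
  have A: "t * measure M S \<le> measure M {x\<in>S. tag_rank S x \<le> t} \<and> measure M {x\<in>S. tag_rank S x < t} \<le> t * measure M S"
    if t: "0 \<le> t" "t \<le> 1" for t
  proof -
    obtain c where c: "tag_cdf S c = t * measure M S"
      using tag_cdf_surj[OF S, of "t * measure M S"] t by (auto simp: mult_left_le_one_le)
    have "{x\<in>S. tag x \<le> c} \<subseteq> {x\<in>S. tag_rank S x \<le> t}"
      using monoD[OF tag_cdf_mono[OF S], of _ c] c pos by (auto simp: tag_rank_def field_simps)
    then have "tag_cdf S c \<le> measure M {x\<in>S. tag_rank S x \<le> t}"
      unfolding tag_cdf_def using S by (intro finite_measure_mono) auto
    moreover have "{x\<in>S. tag_rank S x < t} \<subseteq> {x\<in>S. tag x \<le> c}"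
    proof safe
      fix x assume "x \<in> S" "tag_rank S x < t"
      then have "tag_cdf S (tag x) < tag_cdf S c" using c pos by (simp add: tag_rank_def field_simps)
      then show "tag x \<le> c" using monoD[OF tag_cdf_mono[OF S], of c "tag x"] by linarith
    qed
    then have "measure M {x\<in>S. tag_rank S x < t} \<le> tag_cdf S c"
      unfolding tag_cdf_def using S by (intro finite_measure_mono) auto
    ultimately show ?thesis using c by simp
  qed
  have B: "measure M {x\<in>S. tag_rank S x \<le> t} \<le> measure M {x\<in>S. tag_rank S x < t'}" if "t < t'" for t t'
    using that S by (intro finite_measure_mono) auto
  show ?le
  proof (cases "t = 1")
    case True
    then show ?thesis using rank_bounds(2)[OF S] by simp
  next
    case False
    have "measure M {x\<in>S. tag_rank S x \<le> t} / measure M S \<le> t"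
    proof (rule dense_ge_bounded)
      show "t < 1" using t False by simp
      fix w assume w: "t < w" "w < 1"
      show "measure M {x\<in>S. tag_rank S x \<le> t} / measure M S \<le> w"
        using A[of w] B[OF w(1)] w t pos by (simp add: field_simps)
    qed
    then show ?thesis using A[OF t] pos by (simp add: field_simps)
  qed
  show ?less
  proof (cases "t = 0")
    case True
    then have "{x\<in>S. tag_rank S x < t} = {}" using rank_bounds(1)[OF S] by (auto simp: not_less)
    then show ?thesis using True by (simp only: measure_empty)
  next
    case False
    have "t \<le> measure M {x\<in>S. tag_rank S x < t} / measure M S"
    proof (rule dense_le_bounded)
      show "0 < t" using t False by simp
      fix w assume w: "0 < w" "w < t"
      show "w \<le> measure M {x\<in>S. tag_rank S x < t} / measure M S"
        using A[of w] B[OF w(2)] w t pos by (simp add: field_simps)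
    qed
    then show ?thesis using A[OF t] pos by (simp add: field_simps)
  qed
qed

lemma measure_T_pos: "J \<in> T \<Longrightarrow> 0 < measure M J"
  using T_pos[of J] by (simp add: emeasure_eq_measure)

text \<open>Continuity of \<open>tag_cdf J\<close> allows a threshold c slightly above
  \<open>tag x\<close> whose rank is still below q, and \<open>tag_open\<close> supplies a cell
  around x with tags below c. The strict inequality is essential for this.\<close>

lemma rank_open:
  assumes J: "J \<in> T" and x: "x \<in> J" "tag_rank J x < q"
  shows "\<exists>m. cell m x \<subseteq> {y\<in>J. tag_rank J y < q}"
proof -
  have xs: "x \<in> space M" using J x T_space by blast
  have "tag_cdf J (tag x) < q * measure M J"
    using x measure_T_pos[OF J] by (simp add: tag_rank_def field_simps)
  then have "eventually (\<lambda>c. tag_cdf J c < q * measure M J) (at_right (tag x))"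
    using isCont_tag_cdf[of J "tag x"] J unfolding isCont_def
    by (intro order_tendstoD(2)[of "tag_cdf J" "tag_cdf J (tag x)"])
       (auto intro: filterlim_at_split[THEN iffD1, THEN conjunct2])
  then obtain b where b: "b > tag x" "\<And>c. tag x < c \<Longrightarrow> c < b \<Longrightarrow> tag_cdf J c < q * measure M J"
    by (auto simp: eventually_at_right_field)
  obtain c where c: "tag x < c" "c < b" using dense[OF b(1)] by auto
  obtain m where m: "\<forall>y\<in>cell m x. tag y < c" using tag_open[OF xs c(1)] by auto
  obtain n where n: "cell n x = J" using T_cell[OF J] x by auto
  \<comment> \<open>Depth m controls the tags, depth n keeps the cell inside J.\<close>
  have "cell (max m n) x \<subseteq> {y\<in>J. tag_rank J y < q}"
  proof
    fix y assume "y \<in> cell (max m n) x"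
    then have "y \<in> cell m x" "y \<in> cell n x"
      using cell_antimono[OF xs, of m "max m n"] cell_antimono[OF xs, of n "max m n"] by auto
    then have y: "y \<in> J" "tag y \<le> c" using m n by (auto simp: less_imp_le)
    have "tag_cdf J (tag y) \<le> tag_cdf J c" using tag_cdf_mono[of J] J y by (auto dest: monoD)
    also have "\<dots> < q * measure M J" using b(2) c by simp
    finally have "tag_rank J y < q" using measure_T_pos[OF J] by (simp add: tag_rank_def field_simps)
    then show "y \<in> {y\<in>J. tag_rank J y < q}" using y by simp
  qed
  then show ?thesis by blast
qed

end

subsection \<open>Measurable functions that are uniform on the cells of all strata\<close>

locale tree_scale = tree_space +
  fixes q :: real
  assumes q: "0 < q" "q < 1"
begin

text \<open>The sets of rank below q are broken up into tree cells because the next rank is taken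
  afresh in each cell, and because cells are what the maximal operator averages over.\<close>

primrec strata :: "nat \<Rightarrow> 'a set set" where
  "strata 0 = {space M}"
| "strata (Suc n) = stopping (\<lambda>I. \<exists>J\<in>strata n. I \<subseteq> {x\<in>J. tag_rank J x < q})"

lemma strata_T: "strata n \<subseteq> T"
  by (cases n) (auto simp: space_T dest: set_mp[OF stopping_T])

lemma countable_strata: "countable (strata n)"
  using strata_T countable_T by (rule countable_subset)

lemma disjoint_strata: "disjoint (strata n)"
  by (cases n) (auto simp: disjoint_stopping disjoint_def[of "{_}"])

lemma strata_unique: "I \<in> strata n \<Longrightarrow> J \<in> strata n \<Longrightarrow> x \<in> I \<Longrightarrow> x \<in> J \<Longrightarrow> I = J"
  using disjoint_strata[of n] by (auto simp: disjoint_def)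

lemma strata_SucD: assumes "I \<in> strata (Suc n)" shows "\<exists>J\<in>strata n. I \<subseteq> {x\<in>J. tag_rank J x < q}"
  using stopping_Q[of I] assms by simp

text \<open>\<open>rank_open\<close> puts every point of J of rank below q into a cell that
  qualifies for stopping. The cell actually selected is assigned to some J' of stratum n, and
  disjointness of the stratum forces J' = J.\<close>

lemma strata_step:
  assumes J: "J \<in> strata n"
  shows "\<Union>{I\<in>strata (Suc n). I \<subseteq> J} = {x\<in>J. tag_rank J x < q}"
proof (intro equalityI subsetI)
  fix x assume "x \<in> \<Union>{I\<in>strata (Suc n). I \<subseteq> J}"
  then obtain I where I: "I \<in> strata (Suc n)" "I \<subseteq> J" "x \<in> I" by auto
  obtain J' where J': "J' \<in> strata n" "I \<subseteq> {x\<in>J'. tag_rank J' x < q}" using strata_SucD[OF I(1)] by auto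
  have "J = J'" using strata_unique[OF J J'(1), of x] I J' by blast
  then show "x \<in> {x\<in>J. tag_rank J x < q}" using I J' by blast
next
  fix x assume x: "x \<in> {x\<in>J. tag_rank J x < q}"
  have JT: "J \<in> T" using J strata_T by auto
  have xs: "x \<in> space M" using x JT T_space by blast
  obtain m where m: "cell m x \<subseteq> {y\<in>J. tag_rank J y < q}" using rank_open[OF JT, of x q] x by blast
  have "x \<in> \<Union>(strata (Suc n))"
    unfolding strata.simps
    by (rule mem_Union_stopping[OF cell_T[OF xs, of m] _ mem_cell[OF xs]]) (use m J in blast)
  then obtain I where I: "I \<in> strata (Suc n)" "x \<in> I" by auto
  obtain J' where J': "J' \<in> strata n" "I \<subseteq> {x\<in>J'. tag_rank J' x < q}" using strata_SucD[OF I(1)] by auto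
  have "J = J'" using strata_unique[OF J J'(1), of x] I J' x by blast
  then show "x \<in> \<Union>{I\<in>strata (Suc n). I \<subseteq> J}" using I J' by blast
qed

lemma strata_antimono: "i \<le> j \<Longrightarrow> \<Union>(strata j) \<subseteq> \<Union>(strata i)"
proof (rule lift_Suc_antimono_le[of "\<lambda>n. \<Union>(strata n)"])
  show "\<Union>(strata (Suc n)) \<subseteq> \<Union>(strata n)" for n using strata_SucD[of _ n] by blast
qed

definition exits :: "'a \<Rightarrow> nat \<times> 'a set \<Rightarrow> bool" where
  "exits x p \<longleftrightarrow> snd p \<in> strata (fst p) \<and> x \<in> snd p \<and> q \<le> tag_rank (snd p) x"

text \<open>A point leaving the strata at step \<open>n\<close> has tag rank in \<open>{q..1}\<close> within its cell, so that
  scaling by \<open>q ^ n\<close> makes the values of successive strata adjacent; on the null set of points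
  that never leave, the value is \<open>0\<close>.\<close>

definition profile :: "'a \<Rightarrow> real" where
  "profile x = (if \<exists>p. exits x p then let p = SOME p. exits x p in q ^ fst p * tag_rank (snd p) x else 0)"

lemma exits_not_Suc: assumes "exits x (n, J)" shows "x \<notin> \<Union>(strata (Suc n))"
proof
  assume "x \<in> \<Union>(strata (Suc n))"
  then obtain I where I: "I \<in> strata (Suc n)" "x \<in> I" by auto
  obtain J' where J': "J' \<in> strata n" "I \<subseteq> {x\<in>J'. tag_rank J' x < q}" using strata_SucD[OF I(1)] by auto
  have "J = J'" using strata_unique[of J n J' x] I J' assms by (auto simp: exits_def)
  then show False using I J' assms by (auto simp: exits_def)
qed

lemma exits_le: assumes "exits x (n, J)" "x \<in> \<Union>(strata m)" shows "m \<le> n"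
proof (rule ccontr)
  assume "\<not> m \<le> n"
  then have "x \<in> \<Union>(strata (Suc n))" using strata_antimono[of "Suc n" m] assms by auto
  then show False using exits_not_Suc assms by blast
qed

lemma exits_unique: assumes "exits x p" "exits x p'" shows "p = p'"
proof -
  obtain n J n' J' where p: "p = (n, J)" "p' = (n', J')" by fastforce
  have "n = n'" using exits_le[of x n J n'] exits_le[of x n' J' n] assms p
    by (fastforce simp: exits_def intro: order_antisym)
  then show ?thesis using strata_unique[of J n J' x] assms p by (auto simp: exits_def)
qed

lemma profile_eq: assumes "exits x (n, J)" shows "profile x = q ^ n * tag_rank J x"
proof -
  have "(SOME p. exits x p) = (n, J)" using assms exits_unique by (intro some_equality) auto
  then show ?thesis using assms by (auto simp: profile_def)
qed

lemma profile_cases: obtains "profile x = 0" | n J where "exits x (n, J)" "profile x = q ^ n * tag_rank J x"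
proof (cases "\<exists>p. exits x p")
  case True
  then obtain n J where "exits x (n, J)" by fastforce
  then show ?thesis using profile_eq that by blast
qed (use that in \<open>simp add: profile_def\<close>)

lemma strata_sets: "J \<in> strata n \<Longrightarrow> J \<in> sets M" using strata_T[of n] by auto

lemma profile_nonneg: "0 \<le> profile x"
  by (rule profile_cases[of x]) (use q in \<open>auto simp: exits_def strata_sets rank_bounds\<close>)

lemma profile_le: assumes "x \<in> \<Union>(strata n)" shows "profile x \<le> q ^ n"
proof (rule profile_cases[of x])
  fix m J assume e: "exits x (m, J)" and h: "profile x = q ^ m * tag_rank J x"
  have "n \<le> m" using exits_le e assms by blast
  then have "q ^ m \<le> q ^ n" using q by (intro power_decreasing) auto
  moreover have "q ^ m * tag_rank J x \<le> q ^ m * 1"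
    using e q by (intro mult_left_mono rank_bounds) (auto simp: exits_def strata_sets)
  ultimately show ?thesis using h by simp
qed (use q in simp)

text \<open>The rank at exit is at least q. This bound is the source of the quotient
  \<open>profile x / q\<close> in \<open>maximal_extremal_ge\<close>.\<close>

lemma profile_pos: assumes "0 < profile x"
  obtains n J where "J \<in> strata n" "x \<in> J" "q * q ^ n \<le> profile x"
proof (rule profile_cases[of x])
  fix n J assume e: "exits x (n, J)" "profile x = q ^ n * tag_rank J x"
  then show ?thesis using that[of J n] q by (auto simp: exits_def mult.commute)
qed (use assms in simp)

text \<open>Induction on the number j of further strata needed to reach the scale of t; base case: t
  = q^n. Measurability is carried along, since that of \<open>profile\<close> is itself derived from
  this law.\<close>

lemma profile_law:
  assumes "J \<in> strata n" "q ^ (n + j) \<le> t" "t \<le> q ^ n"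
  shows "J \<inter> {x. profile x \<le> t} \<in> sets M \<and>
    emeasure M (J \<inter> {x. profile x \<le> t}) = ennreal (t / q ^ n) * emeasure M J"
  using assms
proof (induction j arbitrary: n J)
  case (0 n J)
  then have "t = q ^ n" by simp
  moreover have "J \<inter> {x. profile x \<le> q ^ n} = J" using 0 profile_le by blast
  ultimately show ?case using 0 q by (auto simp: strata_sets)
next
  case (Suc j n J)
  have qn: "0 < q ^ n" using q by simp
  have JT: "J \<in> T" using Suc strata_T by auto
  then have pos: "0 < measure M J" by (rule measure_T_pos)
  have t0: "0 < t" using Suc.prems(2) q by (meson less_le_trans zero_less_power)
  show ?case
  proof (cases "q ^ Suc n \<le> t")
    case True
    \<comment> \<open>Points that stay for the next stratum belong to both sides, their profile
      being at most \<open>q ^ Suc n\<close>; for the others the profile is the scaled rank.\<close>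
    have "J \<inter> {x. profile x \<le> t} = {x\<in>J. tag_rank J x \<le> t / q ^ n}"
    proof -
      have "profile x \<le> t \<longleftrightarrow> tag_rank J x \<le> t / q ^ n" if "x \<in> J" for x
      proof (cases "q \<le> tag_rank J x")
        case True
        then show ?thesis using profile_eq[of x n J] that Suc.prems qn by (simp add: exits_def field_simps)
      next
        case False
        then have "x \<in> \<Union>(strata (Suc n))" using strata_step[OF Suc.prems(1)] that by auto
        then have "profile x \<le> t" by (rule order_trans[OF profile_le True])
        moreover have "q \<le> t / q ^ n" using True qn by (simp add: field_simps)
        ultimately show ?thesis using False by linarith
      qed
      then show ?thesis by auto
    qed
    moreover have "measure M {x\<in>J. tag_rank J x \<le> t / q ^ n} = t / q ^ n * measure M J"
      using JT pos t0 qn Suc.prems by (intro measure_rank_le) (auto simp: field_simps)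
    ultimately show ?thesis using JT t0 qn
      by (simp add: emeasure_eq_measure ennreal_mult'[symmetric])
  next
    case False
    define K where "K = {I\<in>strata (Suc n). I \<subseteq> J}"
    have UK: "\<Union>K = {x\<in>J. tag_rank J x < q}" unfolding K_def by (rule strata_step[OF Suc.prems(1)])
    have IH: "I \<inter> {x. profile x \<le> t} \<in> sets M \<and>
      emeasure M (I \<inter> {x. profile x \<le> t}) = ennreal (t / q ^ Suc n) * emeasure M I" if "I \<in> K" for I
      using Suc.prems False that by (intro Suc.IH) (auto simp: K_def)
    have Kc: "countable K" "disjoint K" "K \<subseteq> sets M"
      unfolding K_def using countable_strata[of "Suc n"] disjoint_strata[of "Suc n"] strata_sets
      by (auto simp: disjoint_def simp del: strata.simps)
    \<comment> \<open>Points leaving at stratum n have profile at least q^(n+1) > t, so only the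
      cells of the next stratum count. Their total share q of J turns the factor t / q^(n+1) into t
      / q^n.\<close>
    have eq: "J \<inter> {x. profile x \<le> t} = \<Union>K \<inter> {x. profile x \<le> t}"
    proof -
      have "tag_rank J x < q" if "x \<in> J" "profile x \<le> t" for x
      proof (rule ccontr)
        assume r: "\<not> tag_rank J x < q"
        then have "profile x = q ^ n * tag_rank J x"
          using profile_eq[of x n J] that Suc.prems by (simp add: exits_def)
        moreover have "q ^ n * q \<le> q ^ n * tag_rank J x" using r qn by (intro mult_left_mono) auto
        ultimately show False using False that by (simp add: mult.commute)
      qed
      then show ?thesis unfolding UK by auto
    qed
    have "emeasure M (\<Union>K) = ennreal q * emeasure M J"
      unfolding UK using measure_rank_less[of J q] JT pos q
      by (simp add: emeasure_eq_measure ennreal_mult')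
    then have "emeasure M (\<Union>K \<inter> {x. profile x \<le> t}) = ennreal (t / q ^ Suc n) * (ennreal q * emeasure M J)"
      using emeasure_Union_disjoint_scale(2)[OF Kc, of "{x. profile x \<le> t}"] IH by simp
    also have "\<dots> = ennreal (t / q ^ n) * emeasure M J"
      using q t0 by (simp add: mult.assoc[symmetric] ennreal_mult'[symmetric])
    finally show ?thesis
      unfolding eq using emeasure_Union_disjoint_scale(1)[OF Kc, of "{x. profile x \<le> t}"] IH by blast
  qed
qed

lemma profile_uniform:
  assumes J: "J \<in> strata n" and t: "0 < t" "t \<le> q ^ n"
  shows "J \<inter> {x. profile x \<le> t} \<in> sets M"
    "emeasure M (J \<inter> {x. profile x \<le> t}) = ennreal (t / q ^ n) * emeasure M J"
proof -
  obtain j where "q ^ j < t" using real_arch_pow_inv[OF t(1)] q by auto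
  moreover have "q ^ (n + j) \<le> q ^ j" using q by (intro power_decreasing) auto
  ultimately have "q ^ (n + j) \<le> t" by simp
  then show "J \<inter> {x. profile x \<le> t} \<in> sets M"
    "emeasure M (J \<inter> {x. profile x \<le> t}) = ennreal (t / q ^ n) * emeasure M J"
    using profile_law[OF J _ t(2)] by auto
qed

lemma profile_le_1: "x \<in> space M \<Longrightarrow> profile x \<le> 1" using profile_le[of x 0] by simp

lemma profile_measurable[measurable]: "profile \<in> borel_measurable M"
proof (rule borel_measurableI_le)
  fix t
  have p: "{x\<in>space M. profile x \<le> t} \<in> sets M" if "0 < t" for t
  proof (cases "t \<le> 1")
    case True
    then show ?thesis using profile_uniform(1)[of "space M" 0 t] that by (simp add: Int_def)
  next
    case False
    then have "{x\<in>space M. profile x \<le> t} = space M" using profile_le_1 by force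
    then show ?thesis by simp
  qed
  show "{x\<in>space M. profile x \<le> t} \<in> sets M"
  proof (cases "0 \<le> t")
    case True
    \<comment> \<open>The uniform law says nothing at t = 0, so that level is approached from
      above.\<close>
    have "{x\<in>space M. profile x \<le> t} = (\<Inter>n. {x\<in>space M. profile x \<le> t + 1 / Suc n})"
    proof safe
      fix x assume "x \<in> (\<Inter>n. {x\<in>space M. profile x \<le> t + 1 / real (Suc n)})"
      then have x: "\<And>n. profile x \<le> t + 1 / real (Suc n)" by auto
      show "profile x \<le> t"
        by (rule LIMSEQ_le_const[of "\<lambda>n. t + 1 / real (Suc n)"])
           (use x tendsto_add[OF tendsto_const LIMSEQ_inverse_real_of_nat, of t] in \<open>auto simp: inverse_eq_divide\<close>)
    qed (auto intro: order_trans)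
    also have "\<dots> \<in> sets M" using p True by (intro sets.countable_INT) (auto simp: add_nonneg_pos)
    finally show ?thesis .
  next
    case False
    then have "{x\<in>space M. profile x \<le> t} = {}" using profile_nonneg order_trans by blast
    then show ?thesis by (simp only: sets.empty_sets)
  qed
qed

end

subsection \<open>Layer cake formula and domination\<close>

text \<open>The image of M restricted to S under \<tau> and a multiple of Lebesgue measure on (0,s]
  are finite Borel measures with the same distribution function, hence equal.\<close>

lemma (in finite_measure) nn_integral_uniform_law:
  fixes \<tau> :: "'a \<Rightarrow> real" and f :: "real \<Rightarrow> ennreal"
  assumes S[measurable]: "S \<in> sets M" and \<tau>[measurable]: "\<tau> \<in> borel_measurable M"
    and \<tau>_nonneg: "\<And>x. x \<in> S \<Longrightarrow> 0 \<le> \<tau> x" and s: "0 < s"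
    and law: "\<And>t. 0 < t \<Longrightarrow> t \<le> s \<Longrightarrow> measure M (S \<inter> {x. \<tau> x \<le> t}) = t / s * measure M S"
    and f[measurable]: "f \<in> borel_measurable borel"
  shows "(\<integral>\<^sup>+x\<in>S. f (\<tau> x) \<partial>M) = ennreal (measure M S / s) * (\<integral>\<^sup>+t\<in>{0<..s}. f t \<partial>lborel)"
proof -
  define N1 where "N1 = distr (restrict_space M S) borel \<tau>"
  define N2 where "N2 = density lborel (\<lambda>t. ennreal (measure M S / s) * indicator {0<..s} t)"
  have t[measurable]: "\<tau> \<in> borel_measurable (restrict_space M S)"
    by (intro measurable_restrict_space1) simp
  have sp: "space M \<inter> S = S" using sets.sets_into_space[OF S] by auto
  interpret R: finite_measure "restrict_space M S"
    by (rule finite_measureI) (simp add: emeasure_restrict_space sp space_restrict_space)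
  have N1: "finite_borel_measure N1"
    unfolding N1_def finite_borel_measure_def finite_borel_measure_axioms_def
    by (simp add: R.finite_measure_distr)
  have mS: "S \<inter> {x. \<tau> x \<le> t} \<in> sets M" for t
  proof -
    have "S \<inter> {x. \<tau> x \<le> t} = S \<inter> {x\<in>space M. \<tau> x \<le> t}" using sets.sets_into_space[OF S] by auto
    then show ?thesis by simp
  qed
  have e2: "emeasure N2 B = ennreal (measure M S / s) * emeasure lborel ({0<..s} \<inter> B)" if "B \<in> sets borel" for B
    using that unfolding N2_def
    by (subst emeasure_density) (auto simp: nn_integral_cmult mult.assoc indicator_inter_arith[symmetric])
  have N2: "finite_borel_measure N2"
    unfolding finite_borel_measure_def finite_borel_measure_axioms_def
  proof
    show "finite_measure N2"
    proof (rule finite_measureI)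
      have "emeasure N2 UNIV < \<infinity>" using s by (simp add: e2 ennreal_mult[symmetric])
      then show "emeasure N2 (space N2) \<noteq> \<infinity>" by (simp add: N2_def)
    qed
  qed (simp add: N2_def)
  have "N1 = N2"
  proof (rule cdf_unique'[OF N1 N2], rule ext)
    fix t
    have c1: "cdf N1 t = measure M (S \<inter> {x. \<tau> x \<le> t})"
      unfolding cdf_def N1_def
      by (subst measure_distr) (auto simp: space_restrict_space sp measure_restrict_space vimage_def Int_commute)
    have c2: "cdf N2 t = measure M S / s * measure lborel ({0<..s} \<inter> {..t})"
      using s by (simp add: cdf_def measure_def[of N2] measure_def[of lborel] e2 enn2real_mult)
    consider "t \<le> 0" | "0 < t" "t \<le> s" | "s < t" by linarith
    then show "cdf N1 t = cdf N2 t"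
    proof cases
      case 1
      have "measure M (S \<inter> {x. \<tau> x \<le> t}) \<le> e" if e: "0 < e" for e
      proof -
        \<comment> \<open>Chosen so that \<open>law\<close> bounds the mass below d by e; the
          minimum keeps d in the range of \<open>law\<close>, and the added 1 guards against
          \<open>measure M S = 0\<close>.\<close>
        define d where "d = min s (e * s / (measure M S + 1))"
        have d: "0 < d" "d \<le> s" using s e by (auto simp: d_def add_nonneg_pos)
        have "measure M (S \<inter> {x. \<tau> x \<le> t}) \<le> measure M (S \<inter> {x. \<tau> x \<le> d})"
          using 1 d by (intro finite_measure_mono mS) auto
        also have "\<dots> = d / s * measure M S" by (rule law[OF d])
        also have "\<dots> \<le> (e * s / (measure M S + 1)) / s * measure M S"
          using s by (intro mult_right_mono divide_right_mono) (auto simp: d_def)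
        also have "\<dots> = e * (measure M S / (measure M S + 1))" using s by simp
        also have "\<dots> \<le> e * 1" using e by (intro mult_left_mono) (auto simp: divide_le_eq_1 add_nonneg_pos)
        finally show ?thesis by simp
      qed
      then have "measure M (S \<inter> {x. \<tau> x \<le> t}) \<le> 0" by (rule field_le_epsilon[of _ 0, simplified])
      then have "measure M (S \<inter> {x. \<tau> x \<le> t}) = 0" by (simp add: order_antisym)
      moreover have "{0<..s} \<inter> {..t} = {}" using 1 by auto
      ultimately show ?thesis unfolding c1 c2 by (simp only: measure_empty)
    next
      case 2
      then have "{0<..s} \<inter> {..t} = {0<..t}" by auto
      then show ?thesis using 2 by (simp add: c1 c2 law)
    next
      case 3
      have "measure M S = measure M (S \<inter> {x. \<tau> x \<le> s})" using law[of s] s by simp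
      also have "\<dots> \<le> measure M (S \<inter> {x. \<tau> x \<le> t})"
        using 3 by (intro finite_measure_mono mS) auto
      finally have "measure M S \<le> measure M (S \<inter> {x. \<tau> x \<le> t})" .
      then have "measure M (S \<inter> {x. \<tau> x \<le> t}) = measure M S"
        by (rule order_antisym[rotated]) (intro finite_measure_mono, auto)
      moreover have "{0<..s} \<inter> {..t} = {0<..s}" using 3 by auto
      ultimately show ?thesis using s by (simp add: c1 c2)
    qed
  qed
  have "(\<integral>\<^sup>+x\<in>S. f (\<tau> x) \<partial>M) = (\<integral>\<^sup>+t. f t \<partial>N1)"
    unfolding N1_def by (simp add: nn_integral_distr nn_integral_restrict_space sp)
  also have "\<dots> = (\<integral>\<^sup>+t. ennreal (measure M S / s) * (f t * indicator {0<..s} t) \<partial>lborel)"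
    unfolding \<open>N1 = N2\<close> N2_def by (simp add: nn_integral_density mult_ac)
  also have "\<dots> = ennreal (measure M S / s) * (\<integral>\<^sup>+t\<in>{0<..s}. f t \<partial>lborel)"
    by (intro nn_integral_cmult) measurable
  finally show ?thesis .
qed

text \<open>Tonelli, with X x written as the length of the interval [0, X x]. The weight f permits a
  second application to another factor, and sigma-finiteness makes the formula usable for Lebesgue
  measure as well.\<close>

lemma (in sigma_finite_measure) nn_integral_layer_cake:
  fixes X :: "'a \<Rightarrow> real" and f :: "'a \<Rightarrow> ennreal"
  assumes [measurable]: "X \<in> borel_measurable M" "f \<in> borel_measurable M"
    and nonneg: "\<And>x. x \<in> space M \<Longrightarrow> 0 \<le> X x"
  shows "(\<integral>\<^sup>+x. ennreal (X x) * f x \<partial>M) =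
    (\<integral>\<^sup>+a\<in>{0..}. (\<integral>\<^sup>+x. f x * indicator {x. a \<le> X x} x \<partial>M) \<partial>lborel)"
proof -
  interpret P: pair_sigma_finite M lborel ..
  have "(\<integral>\<^sup>+x. ennreal (X x) * f x \<partial>M) =
      (\<integral>\<^sup>+x. (\<integral>\<^sup>+a. (if 0 \<le> a \<and> a \<le> X x then f x else 0) \<partial>lborel) \<partial>M)"
  proof (rule nn_integral_cong)
    fix x assume x: "x \<in> space M"
    have "(\<integral>\<^sup>+a. (if 0 \<le> a \<and> a \<le> X x then f x else 0) \<partial>lborel) =
        (\<integral>\<^sup>+a. f x * indicator {0..X x} a \<partial>lborel)"
      by (intro nn_integral_cong) (auto simp: indicator_def)
    also have "\<dots> = ennreal (X x) * f x"
      using nonneg[OF x] by (simp add: nn_integral_cmult_indicator mult.commute)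
    finally show "ennreal (X x) * f x = (\<integral>\<^sup>+a. (if 0 \<le> a \<and> a \<le> X x then f x else 0) \<partial>lborel)" ..
  qed
  also have "\<dots> = (\<integral>\<^sup>+a. (\<integral>\<^sup>+x. (if 0 \<le> a \<and> a \<le> X x then f x else 0) \<partial>M) \<partial>lborel)"
    by (rule P.Fubini'[symmetric]) measurable
  also have "\<dots> = (\<integral>\<^sup>+a\<in>{0..}. (\<integral>\<^sup>+x. f x * indicator {x. a \<le> X x} x \<partial>M) \<partial>lborel)"
  proof (rule nn_integral_cong)
    fix a :: real
    show "(\<integral>\<^sup>+x. (if 0 \<le> a \<and> a \<le> X x then f x else 0) \<partial>M) =
        (\<integral>\<^sup>+x. f x * indicator {x. a \<le> X x} x \<partial>M) * indicator {0..} a"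
    proof (cases "0 \<le> a")
      case True
      have "(\<integral>\<^sup>+x. (if 0 \<le> a \<and> a \<le> X x then f x else 0) \<partial>M) = (\<integral>\<^sup>+x. f x * indicator {x. a \<le> X x} x \<partial>M)"
        using True by (intro nn_integral_cong) (auto simp: indicator_def)
      then show ?thesis using True by simp
    qed simp
  qed
  finally show ?thesis .
qed

text \<open>For non-increasing \<open>Y\<close>, this says that the rearrangement of \<open>X\<close> lies below \<open>Y\<close>.\<close>

definition (in prob_space) dominated :: "('a \<Rightarrow> real) \<Rightarrow> (real \<Rightarrow> real) \<Rightarrow> bool" where
  "dominated X Y \<longleftrightarrow>
     (\<forall>a\<ge>0. \<forall>t\<in>{0<..1}. t < prob {x\<in>space M. a \<le> X x} \<longrightarrow> a \<le> Y t)"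

lemma (in prob_space) dominatedD:
  "dominated X Y \<Longrightarrow> 0 \<le> a \<Longrightarrow> 0 < t \<Longrightarrow> t < prob {x\<in>space M. a \<le> X x} \<Longrightarrow> a \<le> Y t"
  unfolding dominated_def using prob_le_1[of "{x\<in>space M. a \<le> X x}"]
  by (metis greaterThanAtMost_iff less_imp_le less_le_trans)

text \<open>The set P of arguments where G reaches a is upward closed, hence a closed or an open
  half-line. In the open case {X in P} is an increasing union of sets {X >= p} with p in P, and
  since t lies strictly below its probability, one such p suffices. Continuity of G is never
  involved.\<close>

lemma (in prob_space) dominated_mono:
  assumes dom: "dominated X Y" and [measurable]: "X \<in> borel_measurable M"
    and X: "\<And>x. x \<in> space M \<Longrightarrow> 0 \<le> X x" and Y: "\<And>t. t \<in> {0<..1} \<Longrightarrow> 0 \<le> Y t"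
    and G: "mono_on {0..} G"
  shows "dominated (\<lambda>x. G (X x)) (\<lambda>t. G (Y t))"
  unfolding dominated_def
proof safe
  fix a t :: real assume a: "0 \<le> a" and t: "t \<in> {0<..1}" and less: "t < prob {x\<in>space M. a \<le> G (X x)}"
  define P where "P = {y. 0 \<le> y \<and> a \<le> G y}"
  have up: "y \<in> P" if "p \<in> P" "p \<le> y" for p y
    using that mono_onD[OF G, of p y] by (auto simp: P_def)
  have eqP: "{x\<in>space M. a \<le> G (X x)} = {x\<in>space M. X x \<in> P}" using X by (auto simp: P_def)
  have bdd: "bdd_below P" unfolding P_def by (rule bdd_belowI[of _ 0]) simp
  have "{x\<in>space M. X x \<in> P} \<noteq> {}" using less t unfolding eqP by (metis greaterThanAtMost_iff less_asym measure_empty)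
  then have "P \<noteq> {}" by auto
  define i where "i = Inf P"
  have i0: "0 \<le> i" unfolding i_def by (rule cInf_greatest[OF \<open>P \<noteq> {}\<close>]) (simp add: P_def)
  have "\<exists>p\<in>P. t < prob {x\<in>space M. p \<le> X x}"
  proof (cases "i \<in> P")
    case True
    have "X x \<in> P \<longleftrightarrow> i \<le> X x" for x
      using up[OF True] cInf_lower[OF _ bdd] by (auto simp: i_def)
    then show ?thesis using True less unfolding eqP by auto
  next
    case False
    have above: "y \<in> P" if iy: "i < y" for y
    proof -
      obtain p where "p \<in> P" "p < y" using iy cInf_lessD[OF \<open>P \<noteq> {}\<close>, of y] unfolding i_def by blast
      then show ?thesis using up by simp
    qed
    have eqi: "y \<in> P \<longleftrightarrow> i < y" for y
      using above[of y] False cInf_lower[OF _ bdd, of y] by (auto simp: i_def less_le)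
    have "i < y \<longleftrightarrow> (\<exists>n. i + 1 / real (Suc n) \<le> y)" for y
    proof
      assume "i < y"
      then obtain n where "1 / real (Suc n) < y - i" using nat_approx_posE[of "y - i"] by auto
      then show "\<exists>n. i + 1 / real (Suc n) \<le> y" by (intro exI[of _ n]) linarith
    next
      assume "\<exists>n. i + 1 / real (Suc n) \<le> y"
      then obtain n where "i + 1 / real (Suc n) \<le> y" by auto
      moreover have "0 < 1 / real (Suc n)" by simp
      ultimately show "i < y" by linarith
    qed
    then have "{x\<in>space M. X x \<in> P} = (\<Union>n. {x\<in>space M. i + 1 / real (Suc n) \<le> X x})"
      unfolding eqi by blast
    moreover have "(\<lambda>n. prob {x\<in>space M. i + 1 / real (Suc n) \<le> X x}) \<longlonglongrightarrow>
        prob (\<Union>n. {x\<in>space M. i + 1 / real (Suc n) \<le> X x})"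
    proof (rule finite_Lim_measure_incseq)
      show "incseq (\<lambda>n. {x\<in>space M. i + 1 / real (Suc n) \<le> X x})"
        by (rule incseq_SucI) (auto elim!: order_trans[rotated] intro!: divide_left_mono)
    qed auto
    ultimately have "eventually (\<lambda>n. t < prob {x\<in>space M. i + 1 / real (Suc n) \<le> X x}) sequentially"
      using less eqP by (auto intro: order_tendstoD)
    then obtain n where "t < prob {x\<in>space M. i + 1 / real (Suc n) \<le> X x}" by (auto simp: eventually_sequentially)
    moreover have "i + 1 / real (Suc n) \<in> P" by (rule above) simp
    ultimately show ?thesis by blast
  qed
  then obtain p where p: "p \<in> P" "t < prob {x\<in>space M. p \<le> X x}" by auto
  have "p \<le> Y t" using dom p t unfolding dominated_def by (auto simp: P_def)
  then have "Y t \<in> P" using up p by blast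
  then show "a \<le> G (Y t)" by (simp add: P_def)
qed

lemma (in prob_space) nn_integral_dominated_le:
  fixes X1 X2 :: "'a \<Rightarrow> real" and Y1 Y2 :: "real \<Rightarrow> real"
  assumes dom: "dominated X1 Y1" "dominated X2 Y2"
    and [measurable]: "X1 \<in> borel_measurable M" "X2 \<in> borel_measurable M"
      "Y1 \<in> borel_measurable borel" "Y2 \<in> borel_measurable borel" "K \<in> sets M"
    and X1: "\<And>x. x \<in> space M \<Longrightarrow> 0 \<le> X1 x" and X2: "\<And>x. x \<in> space M \<Longrightarrow> 0 \<le> X2 x"
    and Y1: "\<And>t. 0 \<le> Y1 t" and Y2: "\<And>t. 0 \<le> Y2 t"
  shows "(\<integral>\<^sup>+x\<in>K. ennreal (X1 x * X2 x) \<partial>M) \<le> (\<integral>\<^sup>+t\<in>{0<..prob K}. ennreal (Y1 t * Y2 t) \<partial>lborel)"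
proof -
  have "(\<integral>\<^sup>+x\<in>K. ennreal (X1 x * X2 x) \<partial>M) = (\<integral>\<^sup>+x. ennreal (X1 x) * (ennreal (X2 x) * indicator K x) \<partial>M)"
    using X1 X2 by (intro nn_integral_cong) (auto simp: ennreal_mult mult.assoc)
  also have "\<dots> = (\<integral>\<^sup>+a\<in>{0..}. (\<integral>\<^sup>+x. ennreal (X2 x) * (indicator K x * indicator {x. a \<le> X1 x} x) \<partial>M) \<partial>lborel)"
    by (subst nn_integral_layer_cake) (auto simp: X1 mult.assoc)
  also have "\<dots> = (\<integral>\<^sup>+a\<in>{0..}. (\<integral>\<^sup>+b\<in>{0..}. (\<integral>\<^sup>+x. indicator K x * indicator {x. a \<le> X1 x} x * indicator {x. b \<le> X2 x} x \<partial>M) \<partial>lborel) \<partial>lborel)"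
    by (subst nn_integral_layer_cake) (auto simp: X2)
  also have "\<dots> \<le> (\<integral>\<^sup>+a\<in>{0..}. (\<integral>\<^sup>+b\<in>{0..}. (\<integral>\<^sup>+t. indicator {0<..prob K} t * indicator {t. a \<le> Y1 t} t * indicator {t. b \<le> Y2 t} t \<partial>lborel) \<partial>lborel) \<partial>lborel)"
  proof (intro nn_integral_mono)
    fix a b :: real
    show "(\<integral>\<^sup>+b\<in>{0..}. (\<integral>\<^sup>+x. indicator K x * indicator {x. a \<le> X1 x} x * indicator {x. b \<le> X2 x} x \<partial>M) \<partial>lborel) * indicator {0..} a
      \<le> (\<integral>\<^sup>+b\<in>{0..}. (\<integral>\<^sup>+t. indicator {0<..prob K} t * indicator {t. a \<le> Y1 t} t * indicator {t. b \<le> Y2 t} t \<partial>lborel) \<partial>lborel) * indicator {0..} a"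
    proof (cases "0 \<le> a")
      case a: True
      show ?thesis
      proof (rule mult_right_mono, rule nn_integral_mono)
        fix b :: real
        show "(\<integral>\<^sup>+x. indicator K x * indicator {x. a \<le> X1 x} x * indicator {x. b \<le> X2 x} x \<partial>M) * indicator {0..} b
          \<le> (\<integral>\<^sup>+t. indicator {0<..prob K} t * indicator {t. a \<le> Y1 t} t * indicator {t. b \<le> Y2 t} t \<partial>lborel) * indicator {0..} b"
        proof (cases "0 \<le> b")
          case b: True
          define A where "A = {x\<in>K. a \<le> X1 x \<and> b \<le> X2 x}"
          have KM: "K \<subseteq> space M" by (rule sets.sets_into_space) simp
          have "A = K \<inter> {x\<in>space M. a \<le> X1 x} \<inter> {x\<in>space M. b \<le> X2 x}"
            unfolding A_def using KM by auto
          then have A[measurable]: "A \<in> sets M" by simp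
          have "(\<integral>\<^sup>+x. indicator K x * indicator {x. a \<le> X1 x} x * indicator {x. b \<le> X2 x} x \<partial>M) = (\<integral>\<^sup>+x. indicator A x \<partial>M)"
            by (intro nn_integral_cong) (auto simp: A_def indicator_def)
          also have "\<dots> = ennreal (prob A)" by (simp add: emeasure_eq_measure)
          \<comment> \<open>An interval of the same measure as A, open on the right because
            \<open>dominated\<close> speaks about t strictly below the probability.\<close>
          also have "\<dots> = emeasure lborel {0<..<prob A}" by simp
          also have "\<dots> = (\<integral>\<^sup>+t. indicator {0<..<prob A} t \<partial>lborel)" by simp
          also have "\<dots> \<le> (\<integral>\<^sup>+t. indicator {0<..prob K} t * indicator {t. a \<le> Y1 t} t * indicator {t. b \<le> Y2 t} t \<partial>lborel)"
          proof (rule nn_integral_mono)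
            fix t :: real
            have "t \<in> {0<..prob K} \<and> a \<le> Y1 t \<and> b \<le> Y2 t" if t: "t \<in> {0<..<prob A}"
            proof (intro conjI)
              have "prob A \<le> prob K" by (intro finite_measure_mono) (auto simp: A_def)
              then show "t \<in> {0<..prob K}" using t by auto
              have "prob A \<le> prob {x\<in>space M. a \<le> X1 x}" "prob A \<le> prob {x\<in>space M. b \<le> X2 x}"
                using KM by (auto intro!: finite_measure_mono simp: A_def)
              then show "a \<le> Y1 t" "b \<le> Y2 t" using t a b dominatedD[OF dom(1), of a t] dominatedD[OF dom(2), of b t] by auto
            qed
            then show "indicator {0<..<prob A} t \<le> (indicator {0<..prob K} t * indicator {t. a \<le> Y1 t} t * indicator {t. b \<le> Y2 t} t :: ennreal)"
              by (auto simp: indicator_def)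
          qed
          finally show ?thesis by (intro mult_right_mono) auto
        qed simp
      qed simp
    qed simp
  qed
  also have "\<dots> = (\<integral>\<^sup>+a\<in>{0..}. (\<integral>\<^sup>+t. ennreal (Y2 t) * (indicator {0<..prob K} t * indicator {t. a \<le> Y1 t} t) \<partial>lborel) \<partial>lborel)"
    by (subst lborel.nn_integral_layer_cake) (auto simp: Y2)
  also have "\<dots> = (\<integral>\<^sup>+t. ennreal (Y1 t) * (ennreal (Y2 t) * indicator {0<..prob K} t) \<partial>lborel)"
    by (subst lborel.nn_integral_layer_cake) (auto simp: Y1 mult.assoc)
  also have "\<dots> = (\<integral>\<^sup>+t\<in>{0<..prob K}. ennreal (Y1 t * Y2 t) \<partial>lborel)"
    using Y1 Y2 by (intro nn_integral_cong) (auto simp: ennreal_mult mult.assoc)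
  finally show ?thesis .
qed

section \<open>Measurability and continuity of monotone functions\<close>

text \<open>The hypotheses constrain g on (0,1] only, while the integral lemmas ask for Borel
  measurability and nonnegativity on the whole line.\<close>

definition trunc :: "(real \<Rightarrow> real) \<Rightarrow> real \<Rightarrow> real" where
  "trunc Y t = (if t \<in> {0<..1} then Y t else 0)"

lemma trunc_eq[simp]: "0 < t \<Longrightarrow> t \<le> 1 \<Longrightarrow> trunc Y t = Y t" by (simp add: trunc_def)

lemma trunc_measurable:
  assumes "antimono_on {0<..1} Y" shows "trunc Y \<in> borel_measurable borel"
proof -
  have "mono_on {0<..1} (\<lambda>t. - Y t)" using assms by (auto simp: monotone_on_def)
  then have "(\<lambda>t. - (- Y t)) \<in> borel_measurable (restrict_space borel {0<..1})"
    by (intro borel_measurable_uminus borel_measurable_mono_on_fnc)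
  then have "(\<lambda>t. indicator {0<..1} t *\<^sub>R Y t) \<in> borel_measurable borel"
    by (subst (asm) borel_measurable_restrict_space_iff) auto
  also have "(\<lambda>t. indicator {0<..1} t *\<^sub>R Y t) = trunc Y" by (rule ext) (simp add: trunc_def)
  finally show ?thesis .
qed

text \<open>A monotone function has only countably many discontinuities. Continuity is taken within
  A, so that the end point 1 of (0,1] needs no special care.\<close>

lemma antimono_on_continuous_AE:
  fixes Y :: "real \<Rightarrow> real"
  assumes "antimono_on A Y"
  shows "AE t in lborel. t \<in> A \<longrightarrow> continuous (at t within A) Y"
proof -
  have "mono_on A (\<lambda>t. - Y t)" using assms by (auto simp: monotone_on_def)
  then have "countable {t\<in>A. \<not> continuous (at t within A) (\<lambda>t. - Y t)}" by (rule mono_on_ctble_discont)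
  moreover have "continuous (at t within A) Y" if "continuous (at t within A) (\<lambda>t. - Y t)" for t
    using continuous_minus[OF that] by simp
  ultimately have "countable {t\<in>A. \<not> continuous (at t within A) Y}"
    by (elim countable_subset[rotated]) auto
  then have "{t\<in>A. \<not> continuous (at t within A) Y} \<in> null_sets lborel"
    by (rule countable_imp_null_set_lborel)
  then show ?thesis by (rule AE_I') auto
qed

lemma antimono_on_compose:
  fixes G :: "real \<Rightarrow> real"
  assumes "mono_on {0..} G" "antimono_on A Y" "\<And>t. t \<in> A \<Longrightarrow> 0 \<le> Y t"
  shows "antimono_on A (\<lambda>t. G (Y t))"
  using assms by (auto simp: monotone_on_def)

lemma mono_on_compose_measurable:
  fixes G :: "real \<Rightarrow> real"
  assumes G: "mono_on {0..} G" and X: "X \<in> borel_measurable M" "\<And>x. x \<in> space M \<Longrightarrow> 0 \<le> X x"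
  shows "(\<lambda>x. G (X x)) \<in> borel_measurable M"
proof -
  have "mono (\<lambda>y. G (max 0 y))" using G by (auto intro!: monoI simp: monotone_on_def)
  from measurable_compose[OF X(1) borel_measurable_mono[OF this]]
  have "(\<lambda>x. G (max 0 (X x))) \<in> borel_measurable M" .
  then show ?thesis by (rule measurable_cong[THEN iffD1, rotated]) (simp add: X(2))
qed

subsection \<open>Hardy averages and the maximal operator\<close>

locale decreasing_fun =
  fixes g :: "real \<Rightarrow> real"
  assumes g_antimono: "antimono_on {0<..1} g"
    and g_nonneg: "t \<in> {0<..1} \<Longrightarrow> 0 \<le> g t"
    and g_integrable: "set_integrable lborel {0<..1} g"
begin

definition hardy :: "real \<Rightarrow> real" where
  "hardy t = (1 / t) * (LBINT u:{0<..t}. g u)"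

lemma g_measurable[measurable]: "trunc g \<in> borel_measurable borel"
  by (rule trunc_measurable[OF g_antimono])

lemma trunc_g_nonneg: "0 \<le> trunc g t" using g_nonneg by (simp add: trunc_def)

lemma hardy_nonneg: "t \<in> {0<..1} \<Longrightarrow> 0 \<le> hardy t"
  unfolding hardy_def set_lebesgue_integral_def
  by (intro mult_nonneg_nonneg integral_nonneg_AE) (auto simp: indicator_def g_nonneg)

lemma hardy_nn_integral:
  assumes t: "t \<in> {0<..1}"
  shows "(\<integral>\<^sup>+u\<in>{0<..t}. ennreal (trunc g u) \<partial>lborel) = ennreal (t * hardy t)"
proof -
  have "set_integrable lborel {0<..t} g"
    by (rule set_integrable_subset[OF g_integrable]) (use t in auto)
  then have int: "integrable lborel (\<lambda>u. indicator {0<..t} u * g u)"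
    by (simp add: set_integrable_def)
  have "(\<integral>\<^sup>+u\<in>{0<..t}. ennreal (trunc g u) \<partial>lborel) = (\<integral>\<^sup>+u. ennreal (indicator {0<..t} u * g u) \<partial>lborel)"
    using t by (intro nn_integral_cong) (auto simp: indicator_def)
  also have "\<dots> = ennreal (LBINT u:{0<..t}. g u)"
    unfolding set_lebesgue_integral_def using t g_nonneg
    by (subst nn_integral_eq_integral[OF int]) (auto simp: indicator_def)
  finally show ?thesis using t by (simp add: hardy_def)
qed

text \<open>The substitution u -> t u moves all averages to the fixed domain (0,1], where
  monotonicity of \<open>hardy\<close> can be read off the integrands.\<close>

lemma hardy_rescaled:
  assumes t: "t \<in> {0<..1}"
  shows "ennreal (hardy t) = (\<integral>\<^sup>+u\<in>{0<..1}. ennreal (trunc g (t * u)) \<partial>lborel)"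
proof -
  have "ennreal t * ennreal (hardy t) = (\<integral>\<^sup>+u\<in>{0<..t}. ennreal (trunc g u) \<partial>lborel)"
    using t hardy_nonneg[OF t] by (simp add: hardy_nn_integral ennreal_mult)
  also have "\<dots> = ennreal t * (\<integral>\<^sup>+u. ennreal (trunc g (t * u)) * indicator {0<..t} (t * u) \<partial>lborel)"
    using t by (subst nn_integral_real_affine[where c = t and t = 0]) auto
  also have "(\<integral>\<^sup>+u. ennreal (trunc g (t * u)) * indicator {0<..t} (t * u) \<partial>lborel) =
      (\<integral>\<^sup>+u\<in>{0<..1}. ennreal (trunc g (t * u)) \<partial>lborel)"
    using t by (intro nn_integral_cong) (auto simp: indicator_def zero_less_mult_iff)
  finally show ?thesis using t by (simp add: ennreal_mult_cancel_left)
qed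

lemma hardy_antimono: "antimono_on {0<..1} hardy"
proof (rule monotone_onI)
  fix s t :: real assume st: "s \<in> {0<..1}" "t \<in> {0<..1}" "s \<le> t"
  have "ennreal (hardy t) \<le> ennreal (hardy s)"
    unfolding hardy_rescaled[OF st(1)] hardy_rescaled[OF st(2)]
  proof (rule nn_integral_mono)
    fix u :: real
    have "trunc g (t * u) \<le> trunc g (s * u)" if u: "u \<in> {0<..1}"
    proof -
      have "s * u \<le> t * u" "0 < s * u" "t * u \<le> 1" using st u by (auto intro: mult_right_mono mult_le_one)
      moreover from this have "g (t * u) \<le> g (s * u)" by (intro monotone_onD[OF g_antimono]) auto
      ultimately show ?thesis by (simp add: trunc_def)
    qed
    then show "ennreal (trunc g (t * u)) * indicator {0<..1} u \<le> ennreal (trunc g (s * u)) * indicator {0<..1} u"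
      by (auto simp: indicator_def intro: ennreal_leI)
  qed
  then show "hardy s \<ge> hardy t" using hardy_nonneg[OF st(1)] by (simp add: ennreal_le_iff)
qed

lemma hardy_dilated_antimono:
  assumes "0 < q" shows "antimono_on {0<..1} (\<lambda>t. hardy (min 1 (t / q)))"
proof (rule monotone_onI)
  fix s t :: real assume st: "s \<in> {0<..1}" "t \<in> {0<..1}" "s \<le> t"
  have "s / q \<le> t / q" using st assms by (intro divide_right_mono) auto
  then show "hardy (min 1 (s / q)) \<ge> hardy (min 1 (t / q))"
    using st assms by (intro monotone_onD[OF hardy_antimono]) auto
qed

end

text \<open>With this constant factor \<open>nn_integral_dominated_le\<close> bounds the integral of
  a single function over a set.\<close>

lemma (in prob_space) dominated_one: "dominated (\<lambda>_. 1) (\<lambda>_. 1)"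
proof -
  have "a \<le> 1" if "0 < t" "t < prob {x\<in>space M. a \<le> 1}" for a t :: real
  proof (rule ccontr)
    assume "\<not> a \<le> 1"
    then have "prob {x\<in>space M. a \<le> 1} = 0" by simp
    then show False using that by simp
  qed
  then show ?thesis by (auto simp: dominated_def)
qed

lemma (in prob_space) dominated_trunc: "dominated X (trunc Y) \<longleftrightarrow> dominated X Y"
  by (simp add: dominated_def trunc_def)

locale tree_rearrangement = tree_space + decreasing_fun
begin

text \<open>A countable index set independent of x, as measurability of the supremum
  requires.\<close>

lemma dyadic_maximal_alt:
  "dyadic_maximal M T \<phi> x =
     (SUP I\<in>T. ((\<integral>\<^sup>+y\<in>I. ennreal \<bar>\<phi> y\<bar> \<partial>M) / emeasure M I) * indicator I x)"
  unfolding dyadic_maximal_def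
proof (intro order_antisym SUP_least)
  fix I assume I: "I \<in> {I\<in>T. x \<in> I}"
  show "(\<integral>\<^sup>+y\<in>I. ennreal \<bar>\<phi> y\<bar> \<partial>M) / emeasure M I \<le>
    (SUP I\<in>T. ((\<integral>\<^sup>+y\<in>I. ennreal \<bar>\<phi> y\<bar> \<partial>M) / emeasure M I) * indicator I x)"
    using I by (intro SUP_upper2[of I]) auto
next
  fix I assume I: "I \<in> T"
  show "((\<integral>\<^sup>+y\<in>I. ennreal \<bar>\<phi> y\<bar> \<partial>M) / emeasure M I) * indicator I x \<le>
    (SUP I\<in>{I\<in>T. x \<in> I}. (\<integral>\<^sup>+y\<in>I. ennreal \<bar>\<phi> y\<bar> \<partial>M) / emeasure M I)"
  proof (cases "x \<in> I")
    case True
    then show ?thesis using I by (intro SUP_upper2[of I]) auto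
  qed simp
qed

lemma dyadic_maximal_measurable[measurable]: "dyadic_maximal M T \<phi> \<in> borel_measurable M"
proof -
  have "(\<lambda>x. SUP I\<in>T. ((\<integral>\<^sup>+y\<in>I. ennreal \<bar>\<phi> y\<bar> \<partial>M) / emeasure M I) * indicator I x) \<in> borel_measurable M"
    using countable_T by (intro borel_measurable_SUP) auto
  then show ?thesis by (simp add: dyadic_maximal_alt[abs_def])
qed

lemma dominated_weak_type:
  assumes [measurable]: "\<phi> \<in> borel_measurable M" and \<phi>: "\<And>x. x \<in> space M \<Longrightarrow> 0 \<le> \<phi> x"
    and dom: "dominated \<phi> g" and a: "0 \<le> a"
    and pos: "0 < prob {x\<in>space M. ennreal a < dyadic_maximal M T \<phi> x}"
  shows "a \<le> hardy (prob {x\<in>space M. ennreal a < dyadic_maximal M T \<phi> x})"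
proof -
  define E where "E = {x\<in>space M. ennreal a < dyadic_maximal M T \<phi> x}"
  define Q where "Q I \<longleftrightarrow> ennreal a < (\<integral>\<^sup>+y\<in>I. ennreal \<bar>\<phi> y\<bar> \<partial>M) / emeasure M I" for I
  \<comment> \<open>The strict inequality matters: a supremum exceeds a exactly when some member
    does.\<close>
  have E: "E = \<Union>(stopping Q)"
    unfolding Union_stopping E_def Q_def dyadic_maximal_def
    using T_space by (auto simp: less_SUP_iff)
  have [measurable]: "E \<in> sets M" unfolding E_def by measurable
  define N where "N = density M (\<lambda>y. ennreal \<bar>\<phi> y\<bar>)"
  have "ennreal a * emeasure M (\<Union>(stopping Q)) \<le> emeasure N (\<Union>(stopping Q))"
  proof (rule emeasure_Union_disjoint_mono[OF countable_stopping disjoint_stopping])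
    show "stopping Q \<subseteq> sets M" using stopping_T T_sets by blast
    fix J assume J: "J \<in> stopping Q"
    then have JT: "J \<in> T" using stopping_T by blast
    have "ennreal a * emeasure M J \<le> ((\<integral>\<^sup>+y\<in>J. ennreal \<bar>\<phi> y\<bar> \<partial>M) / emeasure M J) * emeasure M J"
      using stopping_Q[OF J] by (intro mult_right_mono) (auto simp: Q_def)
    also have "\<dots> = (\<integral>\<^sup>+y\<in>J. ennreal \<bar>\<phi> y\<bar> \<partial>M)"
      using T_pos[OF JT] ennreal_divide_self[of "emeasure M J"] by (auto simp: ennreal_divide_times less_top[symmetric])
    also have "\<dots> = emeasure N J" using JT by (simp add: N_def emeasure_density)
    finally show "ennreal a * emeasure M J \<le> emeasure N J" .
  qed (simp add: N_def)
  then have "ennreal a * emeasure M E \<le> emeasure N E" by (simp add: E)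
  also have "\<dots> = (\<integral>\<^sup>+x\<in>E. ennreal (1 * \<phi> x) \<partial>M)"
    unfolding N_def by (subst emeasure_density) (auto intro!: nn_integral_cong simp: \<phi>)
  also have "\<dots> \<le> (\<integral>\<^sup>+t\<in>{0<..prob E}. ennreal (1 * trunc g t) \<partial>lborel)"
    by (rule nn_integral_dominated_le) (auto simp: dominated_one dominated_trunc dom \<phi> trunc_g_nonneg)
  also have "\<dots> = ennreal (prob E * hardy (prob E))"
    using hardy_nn_integral[of "prob E"] pos by (simp add: E_def)
  finally have "ennreal (prob E * a) \<le> ennreal (prob E * hardy (prob E))"
    using a by (simp add: emeasure_eq_measure ennreal_mult[symmetric] mult.commute)
  then have "prob E * a \<le> prob E * hardy (prob E)"
    using hardy_nonneg[of "prob E"] pos by (subst (asm) ennreal_le_iff) (auto simp: E_def)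
  then show ?thesis using pos by (simp add: E_def)
qed

text \<open>\<open>dominated_weak_type\<close> treats strict superlevel sets, so a is approached by
  levels w < a. Where the maximal function is infinite, \<open>enn2real\<close> gives 0, which only
  shrinks the set to be bounded.\<close>

lemma dominated_maximal:
  assumes [measurable]: "\<phi> \<in> borel_measurable M" and \<phi>: "\<And>x. x \<in> space M \<Longrightarrow> 0 \<le> \<phi> x"
    and dom: "dominated \<phi> g"
  shows "dominated (\<lambda>x. enn2real (dyadic_maximal M T \<phi> x)) hardy"
  unfolding dominated_def
proof safe
  fix a t :: real assume a: "0 \<le> a" and t: "t \<in> {0<..1}"
    and less: "t < prob {x\<in>space M. a \<le> enn2real (dyadic_maximal M T \<phi> x)}"
  show "a \<le> hardy t"
  proof (cases "a = 0")
    case False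
    then have "0 < a" using a by simp
    then show ?thesis
    proof (rule dense_le_bounded)
      fix w assume w: "0 < w" "w < a"
      let ?E = "{x\<in>space M. ennreal w < dyadic_maximal M T \<phi> x}"
      have "prob {x\<in>space M. a \<le> enn2real (dyadic_maximal M T \<phi> x)} \<le> prob ?E"
      proof (rule finite_measure_mono)
        show "{x\<in>space M. a \<le> enn2real (dyadic_maximal M T \<phi> x)} \<subseteq> ?E"
        proof safe
          fix x assume "a \<le> enn2real (dyadic_maximal M T \<phi> x)"
          then show "ennreal w < dyadic_maximal M T \<phi> x"
            using w by (cases "dyadic_maximal M T \<phi> x") (auto simp: ennreal_less_iff)
        qed
      qed measurable
      then have tE: "t < prob ?E" using less by simp
      have "w \<le> hardy (prob ?E)" using tE t w by (intro dominated_weak_type \<phi> dom) auto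
      also have "\<dots> \<le> hardy t" using tE t by (intro monotone_onD[OF hardy_antimono]) auto
      finally show "w \<le> hardy t" .
    qed
  qed (use hardy_nonneg[OF t] in simp)
qed

lemma AE_maximal_finite:
  assumes [measurable]: "\<phi> \<in> borel_measurable M" and \<phi>: "\<And>x. x \<in> space M \<Longrightarrow> 0 \<le> \<phi> x"
    and dom: "dominated \<phi> g"
  shows "AE x in M. dyadic_maximal M T \<phi> x < \<top>"
proof -
  let ?S = "{x\<in>space M. dyadic_maximal M T \<phi> x = \<top>}"
  have "prob ?S = 0"
  proof (rule ccontr)
    assume "prob ?S \<noteq> 0"
    then have p: "0 < prob ?S" by (simp add: less_le)
    \<comment> \<open>A level above the largest value that the weak type bound permits on a set
      containing \<open>?S\<close>.\<close>
    define a where "a = hardy (prob ?S) + 1"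
    have a: "0 \<le> a" using hardy_nonneg[of "prob ?S"] p by (simp add: a_def)
    let ?E = "{x\<in>space M. ennreal a < dyadic_maximal M T \<phi> x}"
    have le: "prob ?S \<le> prob ?E" by (intro finite_measure_mono) auto
    have "a \<le> hardy (prob ?E)" using le p by (intro dominated_weak_type \<phi> dom a) auto
    also have "\<dots> \<le> hardy (prob ?S)" using le p by (intro monotone_onD[OF hardy_antimono]) auto
    finally show False by (simp add: a_def)
  qed
  then have "AE x in M. \<not> dyadic_maximal M T \<phi> x = \<top>"
    by (subst AE_iff_measurable[OF _ refl]) (auto simp: emeasure_eq_measure)
  then show ?thesis by (simp add: less_top)
qed

text \<open>The rearrangement is known almost everywhere only, so t is replaced by a good s between
  t and the measure of {\<phi> >= a}. A subset e of that set with measure exactly s gives a <= g s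
  <= g t.\<close>

lemma dominated_of_rearrangement:
  assumes [measurable]: "\<phi> \<in> borel_measurable M" and \<phi>: "\<And>x. x \<in> space M \<Longrightarrow> 0 \<le> \<phi> x"
    and rearr: "AE t in lborel. t \<in> {0<..1} \<longrightarrow> decr_rearrangement M \<phi> t = ennreal (g t)"
  shows "dominated \<phi> g"
  unfolding dominated_def
proof safe
  fix a t :: real assume a: "0 \<le> a" and t: "t \<in> {0<..1}" and less: "t < prob {x\<in>space M. a \<le> \<phi> x}"
  define S where "S = {x\<in>space M. a \<le> \<phi> x}"
  have [measurable]: "S \<in> sets M" by (simp add: S_def)
  obtain s where s: "t < s" "s < prob S" "s \<in> {0<..1} \<longrightarrow> decr_rearrangement M \<phi> s = ennreal (g s)"
  proof (rule ccontr)
    assume *: "\<not> thesis"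
    from rearr have "AE s in lborel. s \<notin> {t<..<prob S}"
    proof eventually_elim
      case (elim s)
      then show ?case using that[of s] * by auto
    qed
    then have "emeasure lborel {t<..<prob S} = 0"
      by (subst (asm) AE_iff_measurable[of "{t<..<prob S}"]) auto
    then show False using less by (simp add: S_def)
  qed
  have s1: "s \<in> {0<..1}" using s(1,2) t prob_le_1[of S] by (auto simp del: prob_le_1)
  obtain c where c: "tag_cdf S c = s" using tag_cdf_surj[of S s] s s1 by auto
  define e where "e = {y\<in>S. tag y \<le> c}"
  have e: "e \<in> sets M" "emeasure M e = ennreal s"
    using c by (auto simp: e_def tag_cdf_def emeasure_eq_measure)
  have "ennreal a \<le> (INF x\<in>e. ennreal \<bar>\<phi> x\<bar>)"
    using a by (intro INF_greatest) (auto simp: e_def S_def intro: ennreal_leI)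
  also have "\<dots> \<le> decr_rearrangement M \<phi> s"
    unfolding decr_rearrangement_def using e by (intro SUP_upper) auto
  also have "\<dots> = ennreal (g s)" using s s1 by simp
  finally have "a \<le> g s" using g_nonneg[OF s1] by (simp add: ennreal_le_iff)
  also have "g s \<le> g t" using s s1 t by (intro monotone_onD[OF g_antimono]) auto
  finally show "a \<le> g t" .
qed

end

subsection \<open>Extremal functions\<close>

locale tree_extremal = tree_rearrangement + tree_scale
begin

text \<open>\<open>trunc\<close> assigns 0 to the null set of points with profile 0, outside the
  domain of g.\<close>

definition extremal :: "'a \<Rightarrow> real" where
  "extremal x = trunc g (profile x)"

lemma extremal_measurable[measurable]: "extremal \<in> borel_measurable M"
  unfolding extremal_def[abs_def] by measurable

lemma extremal_nonneg: "0 \<le> extremal x" by (simp add: extremal_def trunc_g_nonneg)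

lemma prob_profile_le: assumes "0 < t" "t \<le> 1" shows "prob {x\<in>space M. profile x \<le> t} = t"
proof -
  have "space M \<inter> {x. profile x \<le> t} = {x\<in>space M. profile x \<le> t}" by auto
  then show ?thesis using profile_uniform(2)[of "space M" 0 t] assms
    by (simp add: prob_space emeasure_eq_measure)
qed

lemma prob_profile_le_0: "prob {x\<in>space M. profile x \<le> 0} = 0"
proof -
  have "prob {x\<in>space M. profile x \<le> 0} \<le> t" if "0 < t" "t < 1" for t
  proof -
    have "prob {x\<in>space M. profile x \<le> 0} \<le> prob {x\<in>space M. profile x \<le> t}"
      using that by (intro finite_measure_mono) auto
    then show ?thesis using prob_profile_le[of t] that by simp
  qed
  then have "prob {x\<in>space M. profile x \<le> 0} \<le> 0" by (intro dense_ge_bounded[of 0 1]) auto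
  then show ?thesis by (simp add: order_antisym)
qed

lemma AE_profile_pos: "AE x in M. 0 < profile x"
proof -
  have "AE x in M. \<not> profile x \<le> 0"
    by (subst AE_iff_measurable[OF _ refl]) (auto simp: emeasure_eq_measure prob_profile_le_0)
  then show ?thesis by (simp add: not_le)
qed

lemma dominated_extremal: "dominated extremal g"
  unfolding dominated_def
proof safe
  fix a t :: real assume a: "0 \<le> a" and t: "t \<in> {0<..1}" and less: "t < prob {x\<in>space M. a \<le> extremal x}"
  show "a \<le> g t"
  proof (rule ccontr)
    assume "\<not> a \<le> g t"
    then have ga: "g t < a" by simp
    have "prob {x\<in>space M. a \<le> extremal x} \<le> prob {x\<in>space M. profile x \<le> t}"
    proof (rule finite_measure_mono)
      show "{x\<in>space M. a \<le> extremal x} \<subseteq> {x\<in>space M. profile x \<le> t}"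
      proof safe
        fix x assume x: "x \<in> space M" "a \<le> extremal x"
        show "profile x \<le> t"
        proof (rule ccontr)
          assume "\<not> profile x \<le> t"
          then have "profile x \<in> {0<..1}" "t \<le> profile x" using profile_le_1[OF x(1)] t by auto
          then have "extremal x \<le> g t" using t monotone_onD[OF g_antimono, of t "profile x"]
            by (simp add: extremal_def)
          then show False using x ga by simp
        qed
      qed
    qed simp
    then show False using less t prob_profile_le[of t] by simp
  qed
qed

text \<open>At a continuity point t of g: a set of measure t does not fit into {profile <= s} for s
  < t, so its infimum is at most g s, and s tends to t. Equality is attained on {0 < profile <=
  t}.\<close>

lemma extremal_rearrangement:
  "AE t in lborel. t \<in> {0<..1} \<longrightarrow> decr_rearrangement M extremal t = ennreal (g t)"
  using antimono_on_continuous_AE[OF g_antimono]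
proof eventually_elim
  case (elim t)
  show ?case
  proof
    assume t: "t \<in> {0<..1}"
    have cont: "continuous (at t within {0<..1}) g" using elim t by simp
    have up: "decr_rearrangement M extremal t \<le> ennreal (g s)" if s: "0 < s" "s < t" for s
      unfolding decr_rearrangement_def
    proof (rule SUP_least)
      fix e assume "e \<in> {e\<in>sets M. emeasure M e = ennreal t}"
      then have e: "e \<in> sets M" "prob e = t" using t by (auto simp: emeasure_eq_measure)
      have "\<exists>x\<in>e. s < profile x"
      proof (rule ccontr)
        assume "\<not> (\<exists>x\<in>e. s < profile x)"
        then have "prob e \<le> prob {x\<in>space M. profile x \<le> s}"
          using sets.sets_into_space[OF e(1)] by (intro finite_measure_mono) auto
        then show False using e s t prob_profile_le[of s] by simp
      qed
      then obtain x where x: "x \<in> e" "s < profile x" by auto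
      have "profile x \<le> 1" using x sets.sets_into_space[OF e(1)] by (intro profile_le_1) auto
      then have "extremal x \<le> g s"
        using monotone_onD[OF g_antimono, of s "profile x"] x s by (simp add: extremal_def)
      then show "(INF x\<in>e. ennreal \<bar>extremal x\<bar>) \<le> ennreal (g s)"
        using x extremal_nonneg[of x] by (intro INF_lower2[of x]) (auto intro: ennreal_leI)
    qed
    have seq: "(\<lambda>n. t * (1 - 1 / real (n + 2))) \<longlonglongrightarrow> t * (1 - 0)"
      by (intro tendsto_intros LIMSEQ_ignore_initial_segment lim_1_over_n)
    have in01: "0 < t * (1 - 1 / real (n + 2)) \<and> t * (1 - 1 / real (n + 2)) < t" for n
      using t by (auto simp: field_simps add_pos_nonneg)
    have "(\<lambda>n. g (t * (1 - 1 / real (n + 2)))) \<longlonglongrightarrow> g t"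
    proof -
      have "t * (1 - 1 / real (n + 2)) \<in> {0<..1}" for n
        using in01[of n] t by auto
      then show ?thesis
        using cont seq unfolding continuous_within_sequentially o_def by auto
    qed
    then have "(\<lambda>n. ennreal (g (t * (1 - 1 / real (n + 2))))) \<longlonglongrightarrow> ennreal (g t)" by (rule tendsto_ennrealI)
    then have le: "decr_rearrangement M extremal t \<le> ennreal (g t)"
      by (rule LIMSEQ_le_const) (use up in01 in blast)
    \<comment> \<open>Points of profile 0 are removed because \<open>extremal\<close> is 0 there,
      possibly below g t.\<close>
    define e where "e = {x\<in>space M. profile x \<le> t} - {x\<in>space M. profile x \<le> 0}"
    have "prob e = t"
      unfolding e_def using t prob_profile_le_0 prob_profile_le[of t]
      by (subst finite_measure_Diff) auto
    then have e: "e \<in> sets M" "emeasure M e = ennreal t" by (auto simp: e_def emeasure_eq_measure)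
    have "ennreal (g t) \<le> (INF x\<in>e. ennreal \<bar>extremal x\<bar>)"
    proof (rule INF_greatest, rule ennreal_leI)
      fix x assume "x \<in> e"
      then have "0 < profile x" "profile x \<le> t" by (auto simp: e_def)
      then show "g t \<le> \<bar>extremal x\<bar>"
        using monotone_onD[OF g_antimono, of "profile x" t] t by (simp add: extremal_def)
    qed
    also have "\<dots> \<le> decr_rearrangement M extremal t"
      unfolding decr_rearrangement_def using e by (intro SUP_upper) auto
    finally show "decr_rearrangement M extremal t = ennreal (g t)" using le by simp
  qed
qed

lemma maximal_extremal_ge:
  assumes x: "x \<in> space M" "0 < profile x"
  shows "ennreal (hardy (min 1 (profile x / q))) \<le> dyadic_maximal M T extremal x"
proof -
  obtain n J where J: "J \<in> strata n" "x \<in> J" "q * q ^ n \<le> profile x" using profile_pos[OF x(2)] .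
  have JT: "J \<in> T" using J strata_T by blast
  have qn: "q ^ n \<in> {0<..1}" using q by (auto intro: power_le_one)
  have law: "prob (J \<inter> {x. profile x \<le> t}) = t / q ^ n * prob J" if "0 < t" "t \<le> q ^ n" for t
    using profile_uniform(2)[OF J(1) that] that qn
    by (simp add: emeasure_eq_measure ennreal_mult[symmetric])
  have "(\<integral>\<^sup>+y\<in>J. ennreal \<bar>extremal y\<bar> \<partial>M) = (\<integral>\<^sup>+y\<in>J. ennreal (trunc g (profile y)) \<partial>M)"
    by (simp add: extremal_def trunc_g_nonneg)
  also have "\<dots> = ennreal (prob J / q ^ n) * (\<integral>\<^sup>+t\<in>{0<..q ^ n}. ennreal (trunc g t) \<partial>lborel)"
    using JT qn law profile_nonneg by (intro nn_integral_uniform_law) auto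
  also have "\<dots> = ennreal (prob J / q ^ n) * ennreal (q ^ n * hardy (q ^ n))"
    by (simp add: hardy_nn_integral[OF qn])
  also have "\<dots> = ennreal (hardy (q ^ n)) * emeasure M J"
    using q hardy_nonneg[OF qn] by (simp add: emeasure_eq_measure ennreal_mult[symmetric] mult_ac)
  finally have "(\<integral>\<^sup>+y\<in>J. ennreal \<bar>extremal y\<bar> \<partial>M) / emeasure M J = ennreal (hardy (q ^ n))"
    using T_pos[OF JT] by (simp add: ennreal_mult_divide_eq)
  then have "ennreal (hardy (q ^ n)) \<le> dyadic_maximal M T extremal x"
    unfolding dyadic_maximal_def using JT J by (intro SUP_upper2[of J]) auto
  \<comment> \<open>From \<open>q * q ^ n <= profile x\<close>, the scale q^n is at most both 1 and
    \<open>profile x / q\<close>, and \<open>hardy\<close> decreases.\<close>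
  moreover have "hardy (min 1 (profile x / q)) \<le> hardy (q ^ n)"
    using qn J x q by (intro monotone_onD[OF hardy_antimono]) (auto simp: field_simps)
  ultimately show ?thesis by (meson ennreal_leI order_trans)
qed

text \<open>As \<open>profile\<close> is uniform on (0,1], the left side becomes an integral over X,
  where the integrands are compared pointwise by \<open>maximal_extremal_ge\<close>.\<close>

lemma extremal_value_ge:
  assumes G1: "mono_on {0..} G1" "\<And>y. 0 \<le> y \<Longrightarrow> 0 \<le> G1 y"
    and G2: "mono_on {0..} G2" "\<And>y. 0 \<le> y \<Longrightarrow> 0 \<le> G2 y" and k: "0 < k" "k \<le> 1"
  shows "(\<integral>\<^sup>+t\<in>{0<..k}. ennreal (G1 (hardy (min 1 (t / q))) * G2 (g t)) \<partial>lborel) \<le>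
    (\<integral>\<^sup>+x\<in>{x\<in>space M. profile x \<le> k}. ennreal (G1 (enn2real (dyadic_maximal M T extremal x)) * G2 (extremal x)) \<partial>M)"
proof -
  define Y1 where "Y1 = trunc (\<lambda>t. G1 (hardy (min 1 (t / q))))"
  define Y2 where "Y2 = trunc (\<lambda>t. G2 (g t))"
  define f where "f t = ennreal (Y1 t * Y2 t) * indicator {..k} t" for t
  have h0: "0 \<le> hardy (min 1 (t / q))" if "t \<in> {0<..1}" for t
    using that q by (intro hardy_nonneg) auto
  have [measurable]: "Y1 \<in> borel_measurable borel" unfolding Y1_def
    using q h0 by (intro trunc_measurable antimono_on_compose[OF G1(1) hardy_dilated_antimono]) auto
  have [measurable]: "Y2 \<in> borel_measurable borel" unfolding Y2_def
    using g_nonneg by (intro trunc_measurable antimono_on_compose[OF G2(1) g_antimono])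
  have "(\<integral>\<^sup>+t\<in>{0<..k}. ennreal (G1 (hardy (min 1 (t / q))) * G2 (g t)) \<partial>lborel) = (\<integral>\<^sup>+t\<in>{0<..1}. f t \<partial>lborel)"
    using k by (intro nn_integral_cong) (auto simp: f_def Y1_def Y2_def indicator_def)
  also have "\<dots> = ennreal (prob (space M) / 1) * (\<integral>\<^sup>+t\<in>{0<..1}. f t \<partial>lborel)"
    by (simp add: prob_space)
  also have "\<dots> = (\<integral>\<^sup>+x\<in>space M. f (profile x) \<partial>M)"
  proof (rule nn_integral_uniform_law[symmetric])
    fix t :: real assume "0 < t" "t \<le> 1"
    moreover have "space M \<inter> {x. profile x \<le> t} = {x\<in>space M. profile x \<le> t}" by auto
    ultimately show "prob (space M \<inter> {x. profile x \<le> t}) = t / 1 * prob (space M)"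
      by (simp add: prob_space prob_profile_le)
  qed (auto simp: f_def[abs_def] profile_nonneg)
  also have "\<dots> \<le> (\<integral>\<^sup>+x\<in>{x\<in>space M. profile x \<le> k}. ennreal (G1 (enn2real (dyadic_maximal M T extremal x)) * G2 (extremal x)) \<partial>M)"
  proof (rule nn_integral_mono_AE)
    \<comment> \<open>Where the maximal function is infinite, \<open>enn2real\<close> returns 0 and
      the pointwise bound could fail.\<close>
    have "AE x in M. dyadic_maximal M T extremal x < \<top>"
      using extremal_nonneg dominated_extremal by (intro AE_maximal_finite) auto
    with AE_profile_pos AE_space
    show "AE x in M. f (profile x) * indicator (space M) x \<le>
      ennreal (G1 (enn2real (dyadic_maximal M T extremal x)) * G2 (extremal x)) * indicator {x\<in>space M. profile x \<le> k} x"
    proof eventually_elim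
      case (elim x)
      then have p: "profile x \<in> {0<..1}" using profile_le_1 by auto
      have "hardy (min 1 (profile x / q)) \<le> enn2real (dyadic_maximal M T extremal x)"
        using maximal_extremal_ge[of x] elim by (cases "dyadic_maximal M T extremal x") auto
      then have "G1 (hardy (min 1 (profile x / q))) \<le> G1 (enn2real (dyadic_maximal M T extremal x))"
        using h0[OF p] by (intro mono_onD[OF G1(1)]) auto
      then have "Y1 (profile x) * Y2 (profile x) \<le> G1 (enn2real (dyadic_maximal M T extremal x)) * G2 (extremal x)"
        using p g_nonneg[OF p] G2(2) by (auto simp: Y1_def Y2_def extremal_def intro!: mult_right_mono)
      then show ?case using elim by (auto simp: f_def indicator_def intro: ennreal_leI)
    qed
  qed
  finally show ?thesis .
qed

end

lemma is_tree_tree_space: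
  assumes "prob_space M" "is_tree M T" shows "\<exists>C. tree_space M T C"
proof -
  obtain C where T: "T \<subseteq> sets M" "space M \<in> T" "\<forall>I\<in>T. emeasure M I > 0"
    and C: "\<forall>I\<in>T. C I \<subseteq> T \<and> countable (C I) \<and> (\<exists>A\<in>C I. \<exists>B\<in>C I. A \<noteq> B) \<and>
               disjoint (C I) \<and> I = \<Union>(C I)"
      "T = (\<Union>m. tree_level M C m)"
      "(\<lambda>m. SUP I\<in>tree_level M C m. emeasure M I) \<longlonglongrightarrow> 0"
    using assms(2) unfolding is_tree_def by blast
  have "tree_space_axioms M T C"
  proof
    fix I assume I: "I \<in> T"
    show "0 < emeasure M I" using T(3) I by blast
    show "C I \<subseteq> T" "countable (C I)" "disjoint (C I)" using bspec[OF C(1) I] by blast+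
    show "\<Union>(C I) = I" using bspec[OF C(1) I] by metis
  qed (rule T C)+
  then show ?thesis using assms(1) by (auto simp: tree_space_def)
qed

section \<open>The two inequalities of the theorem\<close>

context tree_rearrangement begin

lemma maximal_integral_le:
  assumes G1: "mono_on {0..} G1" "\<And>y. 0 \<le> y \<Longrightarrow> 0 \<le> G1 y"
    and G2: "mono_on {0..} G2" "\<And>y. 0 \<le> y \<Longrightarrow> 0 \<le> G2 y"
    and \<phi>[measurable]: "\<phi> \<in> borel_measurable M" and \<phi>_nonneg: "\<And>x. x \<in> space M \<Longrightarrow> 0 \<le> \<phi> x"
    and rearr: "AE t in lborel. t \<in> {0<..1} \<longrightarrow> decr_rearrangement M \<phi> t = ennreal (g t)"
    and K[measurable]: "K \<in> sets M"
  shows "(\<integral>\<^sup>+x\<in>K. ennreal (G1 (enn2real (dyadic_maximal M T \<phi> x)) * G2 (\<phi> x)) \<partial>M) \<le>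
    (\<integral>\<^sup>+t\<in>{0<..prob K}. ennreal (G1 (hardy t) * G2 (g t)) \<partial>lborel)"
proof -
  have dom: "dominated \<phi> g" using \<phi> \<phi>_nonneg rearr by (rule dominated_of_rearrangement)
  have "(\<integral>\<^sup>+x\<in>K. ennreal (G1 (enn2real (dyadic_maximal M T \<phi> x)) * G2 (\<phi> x)) \<partial>M) \<le>
      (\<integral>\<^sup>+t\<in>{0<..prob K}. ennreal (trunc (\<lambda>t. G1 (hardy t)) t * trunc (\<lambda>t. G2 (g t)) t) \<partial>lborel)"
  proof (rule nn_integral_dominated_le)
    show "dominated (\<lambda>x. G1 (enn2real (dyadic_maximal M T \<phi> x))) (trunc (\<lambda>t. G1 (hardy t)))"
      unfolding dominated_trunc
      by (rule dominated_mono[OF dominated_maximal[OF \<phi> \<phi>_nonneg dom]]) (auto simp: hardy_nonneg G1)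
    show "dominated (\<lambda>x. G2 (\<phi> x)) (trunc (\<lambda>t. G2 (g t)))"
      unfolding dominated_trunc
      by (rule dominated_mono[OF dom]) (auto simp: \<phi>_nonneg g_nonneg G2)
    show "(\<lambda>x. G1 (enn2real (dyadic_maximal M T \<phi> x))) \<in> borel_measurable M"
      by (rule mono_on_compose_measurable[OF G1(1)]) auto
    show "(\<lambda>x. G2 (\<phi> x)) \<in> borel_measurable M"
      by (rule mono_on_compose_measurable[OF G2(1)]) (auto simp: \<phi>_nonneg)
    show "trunc (\<lambda>t. G1 (hardy t)) \<in> borel_measurable borel"
      by (intro trunc_measurable antimono_on_compose[OF G1(1) hardy_antimono] hardy_nonneg)
    show "trunc (\<lambda>t. G2 (g t)) \<in> borel_measurable borel"
      by (intro trunc_measurable antimono_on_compose[OF G2(1) g_antimono] g_nonneg)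
  qed (auto simp: G1 G2 \<phi>_nonneg trunc_def hardy_nonneg g_nonneg)
  also have "\<dots> = (\<integral>\<^sup>+t\<in>{0<..prob K}. ennreal (G1 (hardy t) * G2 (g t)) \<partial>lborel)"
  proof (rule nn_integral_cong)
    fix t
    show "ennreal (trunc (\<lambda>t. G1 (hardy t)) t * trunc (\<lambda>t. G2 (g t)) t) * indicator {0<..prob K} t =
      ennreal (G1 (hardy t) * G2 (g t)) * indicator {0<..prob K} t"
      using prob_le_1[of K] by (cases "t \<in> {0<..prob K}") (auto simp del: prob_le_1)
  qed
  finally show ?thesis .
qed

text \<open>S stands for any upper bound of the admissible integrals. For every q the function
  \<open>extremal\<close> and the set {profile <= k} are admissible, so all dilated integrals stay
  below S.\<close>

lemma hardy_integral_le:
  assumes G1: "mono_on {0..} G1" "\<And>y. 0 \<le> y \<Longrightarrow> 0 \<le> G1 y"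
    and G2: "mono_on {0..} G2" "\<And>y. 0 \<le> y \<Longrightarrow> 0 \<le> G2 y"
    and k: "0 < k" "k \<le> 1"
    and S: "\<And>\<phi> K. \<phi> \<in> borel_measurable M \<Longrightarrow> (\<And>x. x \<in> space M \<Longrightarrow> 0 \<le> \<phi> x) \<Longrightarrow>
      AE t in lborel. t \<in> {0<..1} \<longrightarrow> decr_rearrangement M \<phi> t = ennreal (g t) \<Longrightarrow>
      K \<in> sets M \<Longrightarrow> emeasure M K = ennreal k \<Longrightarrow>
      (\<integral>\<^sup>+x\<in>K. ennreal (G1 (enn2real (dyadic_maximal M T \<phi> x)) * G2 (\<phi> x)) \<partial>M) \<le> S"
  shows "(\<integral>\<^sup>+t\<in>{0<..k}. ennreal (G1 (hardy t) * G2 (g t)) \<partial>lborel) \<le> S"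
proof -
  \<comment> \<open>The shift by 2 gives q n >= 1/2, so that all terms lie strictly between 0 and
    1.\<close>
  define q where "q n = 1 - 1 / real (n + 2)" for n
  have q: "0 < q n" "q n < 1" for n by (auto simp: q_def field_simps)
  have q_lim: "q \<longlonglongrightarrow> 1"
  proof -
    have "(\<lambda>n. 1 - 1 / real (n + 2)) \<longlonglongrightarrow> 1 - 0"
      by (intro tendsto_intros LIMSEQ_ignore_initial_segment lim_1_over_n)
    then show ?thesis by (simp add: q_def[abs_def])
  qed
  define h where "h n t = ennreal (G1 (hardy (min 1 (t / q n))) * G2 (g t)) * indicator {0<..k} t" for n t
  define D where "D t = G1 (hardy t)" for t
  have h0: "0 \<le> hardy (min 1 (t / q n))" if "t \<in> {0<..1}" for t n
    using that q[of n] by (intro hardy_nonneg) auto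
  have h_meas: "h n \<in> borel_measurable lborel" for n
  proof -
    have [measurable]: "trunc (\<lambda>t. G1 (hardy (min 1 (t / q n)))) \<in> borel_measurable borel"
      using h0 q[of n] by (intro trunc_measurable antimono_on_compose[OF G1(1) hardy_dilated_antimono])
    have [measurable]: "trunc (\<lambda>t. G2 (g t)) \<in> borel_measurable borel"
      by (intro trunc_measurable antimono_on_compose[OF G2(1) g_antimono] g_nonneg)
    have "h n = (\<lambda>t. ennreal (trunc (\<lambda>t. G1 (hardy (min 1 (t / q n)))) t * trunc (\<lambda>t. G2 (g t)) t) * indicator {0<..k} t)"
      using k by (auto simp: h_def indicator_def)
    then show ?thesis by simp
  qed
  have h_le: "(\<integral>\<^sup>+t. h n t \<partial>lborel) \<le> S" for n
  proof -
    interpret E: tree_extremal M T C g "q n"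
      by unfold_locales (rule q)+
    have "(\<integral>\<^sup>+t. h n t \<partial>lborel) \<le>
      (\<integral>\<^sup>+x\<in>{x\<in>space M. E.profile x \<le> k}. ennreal (G1 (enn2real (dyadic_maximal M T E.extremal x)) * G2 (E.extremal x)) \<partial>M)"
      unfolding h_def using G1 G2 k by (rule E.extremal_value_ge)
    also have "\<dots> \<le> S"
      using k E.extremal_nonneg E.extremal_rearrangement
      by (intro S) (auto simp: emeasure_eq_measure E.prob_profile_le)
    finally show ?thesis .
  qed
  have "(\<integral>\<^sup>+t\<in>{0<..k}. ennreal (G1 (hardy t) * G2 (g t)) \<partial>lborel) \<le> (\<integral>\<^sup>+t. liminf (\<lambda>n. h n t) \<partial>lborel)"
  proof (rule nn_integral_mono_AE)
    have "antimono_on {0<..1} D"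
      unfolding D_def by (rule antimono_on_compose[OF G1(1) hardy_antimono hardy_nonneg])
    from antimono_on_continuous_AE[OF this]
    show "AE t in lborel. ennreal (G1 (hardy t) * G2 (g t)) * indicator {0<..k} t \<le> liminf (\<lambda>n. h n t)"
    proof eventually_elim
      case (elim t)
      show ?case
      proof (cases "t \<in> {0<..k}")
        case True
        then have t: "t \<in> {0<..1}" using k by auto
        \<comment> \<open>The arguments converge to t without leaving (0,1], so continuity of D at t
          within (0,1] suffices; the factor \<open>G2 (g t)\<close> is not dilated.\<close>
        have "(\<lambda>n. min 1 (t / q n)) \<longlonglongrightarrow> min 1 (t / 1)"
          by (intro tendsto_intros q_lim) simp
        then have "(\<lambda>n. min 1 (t / q n)) \<longlonglongrightarrow> t" using t by simp
        moreover have "min 1 (t / q n) \<in> {0<..1}" for n using t q[of n] by auto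
        ultimately have "(\<lambda>n. D (min 1 (t / q n))) \<longlonglongrightarrow> D t"
          using elim t unfolding continuous_within_sequentially o_def by auto
        then have "(\<lambda>n. ennreal (D (min 1 (t / q n)) * G2 (g t))) \<longlonglongrightarrow> ennreal (D t * G2 (g t))"
          by (intro tendsto_intros)
        then have "(\<lambda>n. h n t) \<longlonglongrightarrow> ennreal (G1 (hardy t) * G2 (g t))"
          using True by (simp add: h_def D_def)
        then have "liminf (\<lambda>n. h n t) = ennreal (G1 (hardy t) * G2 (g t))"
          by (intro lim_imp_Liminf) auto
        then show ?thesis using True by simp
      qed simp
    qed
  qed
  also have "\<dots> \<le> liminf (\<lambda>n. \<integral>\<^sup>+t. h n t \<partial>lborel)"
    by (rule nn_integral_liminf[OF h_meas])
  also have "\<dots> \<le> S"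
    by (rule Liminf_le) (auto intro!: always_eventually h_le)
  finally show ?thesis .
qed

end

(* If the rearrangement of \<phi> is a.e. equal to the integrable g, then \<phi> is integrable, so its
   maximal function is finite a.e. and the value of enn2real at infinity plays no role. *)
theorem theorem1:
  fixes M :: "'a measure" and T :: "'a set set"
    and G1 G2 g :: "real \<Rightarrow> real" and k :: real
  assumes "prob_space M" and "nonatomic M" and "is_tree M T"
    and "mono_on {0..} G1" and "\<And>x. x \<ge> 0 \<Longrightarrow> G1 x \<ge> 0"
    and "mono_on {0..} G2" and "\<And>x. x \<ge> 0 \<Longrightarrow> G2 x \<ge> 0"
    and "antimono_on {0<..1} g" and "\<And>t. t \<in> {0<..1} \<Longrightarrow> g t \<ge> 0"
    and "set_integrable lborel {0<..1} g"
    and "0 < k" and "k \<le> 1"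
  shows "Sup {\<integral>\<^sup>+x\<in>K. ennreal (G1 (enn2real (dyadic_maximal M T \<phi> x)) * G2 (\<phi> x)) \<partial>M | \<phi> K.
                \<phi> \<in> borel_measurable M \<and> (\<forall>x\<in>space M. \<phi> x \<ge> 0) \<and>
                (AE t in lborel. t \<in> {0<..1} \<longrightarrow> decr_rearrangement M \<phi> t = ennreal (g t)) \<and>
                K \<in> sets M \<and> emeasure M K = ennreal k}
       = (\<integral>\<^sup>+t\<in>{0<..k}. ennreal (G1 ((1 / t) * (LBINT u:{0<..t}. g u)) * G2 (g t)) \<partial>lborel)"
    (is "Sup ?V = _")
proof -
  obtain C where C: "tree_space M T C" using is_tree_tree_space assms(1,3) by blast
  have "decreasing_fun g" using assms(8,9,10) by (rule decreasing_fun.intro)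
  with C interpret tree_rearrangement M T C g by (rule tree_rearrangement.intro)
  have "Sup ?V = (\<integral>\<^sup>+t\<in>{0<..k}. ennreal (G1 (hardy t) * G2 (g t)) \<partial>lborel)"
  proof (rule order_antisym)
    show "Sup ?V \<le> (\<integral>\<^sup>+t\<in>{0<..k}. ennreal (G1 (hardy t) * G2 (g t)) \<partial>lborel)"
    proof (rule Sup_least)
      fix v assume "v \<in> ?V"
      then obtain \<phi> K where v: "v = (\<integral>\<^sup>+x\<in>K. ennreal (G1 (enn2real (dyadic_maximal M T \<phi> x)) * G2 (\<phi> x)) \<partial>M)"
        and *: "\<phi> \<in> borel_measurable M" "\<And>x. x \<in> space M \<Longrightarrow> \<phi> x \<ge> 0"
          "AE t in lborel. t \<in> {0<..1} \<longrightarrow> decr_rearrangement M \<phi> t = ennreal (g t)"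
          "K \<in> sets M" "emeasure M K = ennreal k"
        by blast
      have "prob K = k" using *(5) assms(11) by (simp add: measure_def)
      then show "v \<le> (\<integral>\<^sup>+t\<in>{0<..k}. ennreal (G1 (hardy t) * G2 (g t)) \<partial>lborel)"
        unfolding v using maximal_integral_le[OF assms(4-7) *(1-4)] by simp
    qed
    show "(\<integral>\<^sup>+t\<in>{0<..k}. ennreal (G1 (hardy t) * G2 (g t)) \<partial>lborel) \<le> Sup ?V"
    proof (rule hardy_integral_le[OF assms(4) _ assms(6) _ assms(11,12)])
      show "0 \<le> G1 y" "0 \<le> G2 y" if "0 \<le> y" for y using assms(5,7) that by blast+
    next
      fix \<phi> :: "'a \<Rightarrow> real" and K
      assume "\<phi> \<in> borel_measurable M" "\<And>x. x \<in> space M \<Longrightarrow> 0 \<le> \<phi> x"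
        "AE t in lborel. t \<in> {0<..1} \<longrightarrow> decr_rearrangement M \<phi> t = ennreal (g t)"
        "K \<in> sets M" "emeasure M K = ennreal k"
      then show "(\<integral>\<^sup>+x\<in>K. ennreal (G1 (enn2real (dyadic_maximal M T \<phi> x)) * G2 (\<phi> x)) \<partial>M) \<le> Sup ?V"
        by (intro Sup_upper CollectI exI[of _ \<phi>] exI[of _ K] conjI refl ballI)
    qed
  qed
  then show ?thesis by (simp only: hardy_def)
qed

end
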